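(* Let $F_{12}$ be the graph on vertices $u,x,y,z,w$ with edge set $\{ux,uy,uz,xy,yz,uw\}$ (i.e., $K_4$ minus an edge, with a pendant edge attached at a vertex of degree $3$), and let $F_{13}$ be the graph on vertices $u,v,x,y,z$ with edge set $\{ux,uy,vx,vy,xy,uz\}$ (i.e., $K_4$ minus an edge, with a pendant edge attached at a vertex of degree $2$). For every integer $k\geq 1$, $$gr_k(K_3 : F_{12})=gr_k(K_3 : F_{13})=\begin{cases} 9\cdot 5^{(k-2)/2}+1, & \text{if } k \text{ is even},\\ 4\cdot 5^{(k-1)/2}+1, & \text{if } k \text{ is odd}.\end{cases}$$
   Context: A $k$-coloring of a graph is an assignment of one of $k$ colors to each edge (not necessarily proper). A subgraph is monochromatic if all its edges have the same color and rainbow if all its edges have distinct colors. For graphs $G$ and $H$, the $k$-colored Gallai-Ramsey number $gr_k(G : H)$ is the minimum integer $N$ such that every $k$-coloring of the edges of $K_N$ contains either a rainbow copy of $G$ or a monochromatic copy of $H$ (copies are subgraphs, not necessarily induced). Here $K_3$ is the triangle. *)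

theory Defs
  imports Main
begin

(* A graph is a pair of a vertex set and a set of edges, an edge being the
   two-element set of its endpoints. *)
type_synonym 'a graph = "'a set \<times> 'a set set"

definition verts :: "'a graph \<Rightarrow> 'a set" where
  "verts G = fst G"

definition edges :: "'a graph \<Rightarrow> 'a set set" where
  "edges G = snd G"

definition simple_graph :: "'a graph \<Rightarrow> bool" where
  "simple_graph G \<longleftrightarrow> (\<forall>e \<in> edges G. e \<subseteq> verts G \<and> card e = 2)"

definition complete_graph :: "nat \<Rightarrow> nat graph" where
  "complete_graph n = ({..<n}, {e. e \<subseteq> {..<n} \<and> card e = 2})"

definition subgraph :: "'a graph \<Rightarrow> 'a graph \<Rightarrow> bool" where
  "subgraph G' G \<longleftrightarrow> simple_graph G' \<and> verts G' \<subseteq> verts G \<and> edges G' \<subseteq> edges G"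

definition isomorphic :: "'a graph \<Rightarrow> 'b graph \<Rightarrow> bool" where
  "isomorphic G H \<longleftrightarrow>
     (\<exists>f. bij_betw f (verts G) (verts H) \<and> edges H = (\<lambda>e. f ` e) ` edges G)"

definition is_copy_in :: "'a graph \<Rightarrow> 'b graph \<Rightarrow> 'a graph \<Rightarrow> bool" where
  "is_copy_in G' G K \<longleftrightarrow> subgraph G' K \<and> isomorphic G G'"

(* The colours are 0, ..., k - 1; not all of them need to be used. The values of
   a colouring on sets that are not edges are irrelevant. *)
definition edge_coloring :: "nat \<Rightarrow> 'a graph \<Rightarrow> ('a set \<Rightarrow> nat) \<Rightarrow> bool" where
  "edge_coloring k G c \<longleftrightarrow> (\<forall>e \<in> edges G. c e < k)"

definition monochromatic :: "('a set \<Rightarrow> nat) \<Rightarrow> 'a graph \<Rightarrow> bool" where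
  "monochromatic c G \<longleftrightarrow> (\<forall>e \<in> edges G. \<forall>e' \<in> edges G. c e = c e')"

definition rainbow :: "('a set \<Rightarrow> nat) \<Rightarrow> 'a graph \<Rightarrow> bool" where
  "rainbow c G \<longleftrightarrow> inj_on c (edges G)"

(* On nat, Inf of a nonempty set is its least element, while Inf {} = 0. For graphs
   G and H with at least one vertex 0 is never a member of the set below, so a
   positive value of gallai_ramsey is always an attained minimum. *)
definition gallai_ramsey :: "nat \<Rightarrow> 'a graph \<Rightarrow> 'b graph \<Rightarrow> nat" where
  "gallai_ramsey k G H = Inf {N. \<forall>c. edge_coloring k (complete_graph N) c \<longrightarrow>
      (\<exists>G'. is_copy_in G' G (complete_graph N) \<and> rainbow c G') \<or>
      (\<exists>H'. is_copy_in H' H (complete_graph N) \<and> monochromatic c H')}"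

(* K_4 minus an edge, with a pendant edge at a vertex of degree 3. *)
definition F12 :: "nat graph" where
  "F12 = (let u = 0; x = 1; y = 2; z = 3; w = 4 in
     ({u, x, y, z, w}, {{u, x}, {u, y}, {u, z}, {x, y}, {y, z}, {u, w}}))"

(* K_4 minus an edge, with a pendant edge at a vertex of degree 2. *)
definition F13 :: "nat graph" where
  "F13 = (let u = 0; v = 1; x = 2; y = 3; z = 4 in
     ({u, v, x, y, z}, {{u, x}, {u, y}, {v, x}, {v, y}, {x, y}, {u, z}}))"

lemma simple_graph_complete_graph: "simple_graph (complete_graph n)"
  by (auto simp: simple_graph_def complete_graph_def verts_def edges_def)

lemma simple_graph_F12: "simple_graph F12"
  by (simp add: simple_graph_def F12_def verts_def edges_def Let_def)

lemma simple_graph_F13: "simple_graph F13"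
  by (simp add: simple_graph_def F13_def verts_def edges_def Let_def)

end

(*
  Lower bound: K_4 (one colour) and the 3x3 rook graph with its complement (two colours, every edge
  in exactly one monochromatic triangle) contain no monochromatic copy; substituting a colouring into
  the vertices of the two-coloured pentagon costs two new colours, multiplies the order by 5, and
  keeps the new colours triangle-free.

  Upper bound, by induction on the number k of colours, with f(k) the claimed extremal order: take a
  Gallai partition with colours r, b between the parts, and let R and B be the red and blue
  neighbourhoods of a part P with |P| >= 3. If two sets of size >= 3 are completely joined in a
  colour, then neither of them contains this colour. So if |R|, |B| >= 3, then P uses neither r nor b,
  all parts inside R are joined by b, all parts inside B by r, and one gets |P| <= f(k-2) and
  |R|, |B| <= 2 f(k-2), in total 5 f(k-2) = f(k). If |R| <= 2 or |B| <= 2, one loses at most a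
  factor 2 for every colour to be removed, because a colour class in the neighbourhood of a
  vertex in this colour is a star forest. If all parts have at most 2 vertices, then there are at
  most 2 f(2) = 18 vertices.
*)

theory Submission
  imports Defs
begin

section \<open>Gallai partitions\<close>

text \<open>Colourings are symmetric functions of two vertices; their values on the diagonal are irrelevant.\<close>

definition rainbow_triangle_free :: "('a \<Rightarrow> 'a \<Rightarrow> nat) \<Rightarrow> 'a set \<Rightarrow> bool" where
  "rainbow_triangle_free d V \<longleftrightarrow> (\<forall>x\<in>V. \<forall>y\<in>V. \<forall>z\<in>V. x \<noteq> y \<longrightarrow> x \<noteq> z \<longrightarrow> y \<noteq> z \<longrightarrow>
     d x y = d x z \<or> d x y = d y z \<or> d x z = d y z)"

section \<open>Components of one colour class\<close>

definition colour_rel :: "('a \<Rightarrow> 'a \<Rightarrow> nat) \<Rightarrow> 'a set \<Rightarrow> nat \<Rightarrow> ('a \<times> 'a) set" where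
  "colour_rel d V i = {(x, y). x \<in> V \<and> y \<in> V \<and> x \<noteq> y \<and> d x y = i}"

lemma rainbow_triangle_freeD:
  assumes "rainbow_triangle_free d V" "x \<in> V" "y \<in> V" "z \<in> V" "x \<noteq> y" "x \<noteq> z" "y \<noteq> z"
  shows "d x y = d x z \<or> d x y = d y z \<or> d x z = d y z"
  using assms unfolding rainbow_triangle_free_def by blast

lemma rainbow_triangle_free_subset:
  "rainbow_triangle_free d V \<Longrightarrow> W \<subseteq> V \<Longrightarrow> rainbow_triangle_free d W"
  unfolding rainbow_triangle_free_def by blast

lemma colour_rel_rtrancl_mem:
  "(x, y) \<in> (colour_rel d V i)\<^sup>* \<Longrightarrow> x \<in> V \<Longrightarrow> y \<in> V"
  by (induction rule: rtrancl_induct) (auto simp: colour_rel_def)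

lemma colour_rel_rtrancl_sym:
  assumes "\<And>x y. d x y = d y x" "(x, y) \<in> (colour_rel d V i)\<^sup>*"
  shows "(y, x) \<in> (colour_rel d V i)\<^sup>*"
proof -
  have "sym (colour_rel d V i)"
    using assms(1) by (auto simp: sym_def colour_rel_def)
  then show ?thesis
    using assms(2) by (meson sym_rtrancl symD)
qed

text \<open>No edge from the component of \<open>x\<close> to \<open>y\<close> has colour
  \<open>i\<close>, since \<open>y\<close> lies outside. So for every edge \<open>u w\<close> of
  colour \<open>i\<close> in the component the triangle \<open>u w y\<close> forces
  \<open>d u y = d w y\<close>, and this propagates along the path.\<close>

lemma colour_component_homogeneous:
  assumes sym: "\<And>x y. d x y = d y x" and free: "rainbow_triangle_free d V"
    and path: "(x, x') \<in> (colour_rel d V i)\<^sup>*" and x: "x \<in> V" and y: "y \<in> V"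
    and sep: "(x, y) \<notin> (colour_rel d V i)\<^sup>*"
  shows "d x y = d x' y"
  using path
proof (induction rule: rtrancl_induct)
  case base
  then show ?case by simp
next
  case (step u w)
  have mem: "u \<in> V" "w \<in> V" "u \<noteq> w" "d u w = i"
    using step.hyps(2) by (auto simp: colour_rel_def)
  have reach: "(x, w) \<in> (colour_rel d V i)\<^sup>*"
    using step.hyps by simp
  then have ne: "u \<noteq> y" "w \<noteq> y"
    using step.hyps(1) sep by auto
  have "d u y \<noteq> i" "d w y \<noteq> i"
    using step.hyps(1) reach sep mem ne y
    by (auto simp: colour_rel_def dest: rtrancl_into_rtrancl)
  then have "d u y = d w y"
    using rainbow_triangle_freeD[OF free mem(1,2) y mem(3) ne] mem(4) by auto
  with step.IH show ?case by simp
qed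

text \<open>Induction on the number of vertices: if every colour is connected on \<open>insert v W\<close>, then every
  colour occurs at \<open>v\<close>; but if colour \<open>a\<close> is disconnected on \<open>W\<close>, then \<open>v\<close> sees only \<open>a\<close> and one
  other colour.\<close>

lemma three_colours_disconnected:
  assumes "finite V" and sym: "\<And>x y. d x y = d y x" and "rainbow_triangle_free d V"
    and "colour_rel d V i \<noteq> {}" "colour_rel d V j \<noteq> {}" "colour_rel d V h \<noteq> {}"
    and "i \<noteq> j" "i \<noteq> h" "j \<noteq> h"
  shows "\<exists>i. colour_rel d V i \<noteq> {} \<and> (\<exists>x\<in>V. \<exists>y\<in>V. (x, y) \<notin> (colour_rel d V i)\<^sup>*)"
  using assms(1,3-)
proof (induction V arbitrary: i j h rule: finite_induct)
  case empty
  then show ?case by (simp add: colour_rel_def)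
next
  case (insert v W)
  let ?V = "insert v W"
  have free: "rainbow_triangle_free d W"
    using insert.prems(1) rainbow_triangle_free_subset by blast
  show ?case
  proof (rule ccontr)
    assume "\<not> ?thesis"
    then have conn: "(x, y) \<in> (colour_rel d ?V l)\<^sup>*"
      if "colour_rel d ?V l \<noteq> {}" "x \<in> ?V" "y \<in> ?V" for l x y
      using that by blast
    have "W \<noteq> {}"
      using insert.prems(2) by (auto simp: colour_rel_def)
    \<comment> \<open>Colour \<open>l\<close> connects \<open>v\<close> to some vertex of
      \<open>W\<close>, and the first edge of such a path is an edge at \<open>v\<close>.\<close>
    have seen: "\<exists>y\<in>W. d v y = l" if l: "colour_rel d ?V l \<noteq> {}" for l
    proof -
      obtain y where "y \<in> W" using \<open>W \<noteq> {}\<close> by blast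
      then have "(v, y) \<in> (colour_rel d ?V l)\<^sup>*" "v \<noteq> y"
        using conn[OF l] insert.hyps(2) by auto
      then obtain z where "(v, z) \<in> colour_rel d ?V l"
        by (meson converse_rtranclE)
      then show ?thesis by (auto simp: colour_rel_def)
    qed
    \<comment> \<open>All three colours survive on \<open>W\<close>: take \<open>y\<close> with
      \<open>d v y = b\<close>; the first edge of an \<open>a\<close>-coloured path from
      \<open>y\<close> to \<open>v\<close> does not end in \<open>v\<close>, so it lies in
      \<open>W\<close>.\<close>
    have used: "\<exists>a b c. a \<noteq> b \<and> a \<noteq> c \<and> b \<noteq> c \<and> colour_rel d W a \<noteq> {} \<and>
        colour_rel d W b \<noteq> {} \<and> colour_rel d W c \<noteq> {}"
    proof -
      have "colour_rel d W a \<noteq> {}"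
        if a: "colour_rel d ?V a \<noteq> {}" and b: "colour_rel d ?V b \<noteq> {}" and "a \<noteq> b" for a b
      proof -
        obtain y where y: "y \<in> W" "d v y = b" using seen[OF b] by blast
        then have "(y, v) \<in> (colour_rel d ?V a)\<^sup>*" "y \<noteq> v"
          using conn[OF a] insert.hyps(2) by auto
        then obtain z where z: "(y, z) \<in> colour_rel d ?V a"
          by (meson converse_rtranclE)
        have "z \<noteq> v"
          using z y(2) \<open>a \<noteq> b\<close> sym[of y v] by (auto simp: colour_rel_def)
        then have "(y, z) \<in> colour_rel d W a"
          using z y(1) by (auto simp: colour_rel_def)
        then show ?thesis by blast
      qed
      then show ?thesis using insert.prems(2-7) by metis
    qed
    obtain a where a: "colour_rel d W a \<noteq> {}"
        "\<exists>x\<in>W. \<exists>y\<in>W. (x, y) \<notin> (colour_rel d W a)\<^sup>*"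
      using used insert.IH[OF free] by metis
    have aV: "colour_rel d ?V a \<noteq> {}"
      using a(1) by (auto simp: colour_rel_def)
    let ?R = "(colour_rel d W a)\<^sup>*"
    have Rsym: "(y, x) \<in> ?R" if "(x, y) \<in> ?R" for x y
      using colour_rel_rtrancl_sym[OF sym that] .
    \<comment> \<open>Every \<open>a\<close>-component of \<open>W\<close> contains an
      \<open>a\<close>-neighbour of \<open>v\<close>, because colour \<open>a\<close> is connected
      on \<open>insert v W\<close>.\<close>
    have attach: "\<exists>z. (x, z) \<in> ?R \<and> z \<in> W \<and> d v z = a" if x: "x \<in> W" for x
    proof -
      \<comment> \<open>Invariant along the walk: it is still inside the component in
        \<open>W\<close>, or an edge from the component to \<open>v\<close> has already been
        found.\<close>
      have "w \<in> W \<and> (x, w) \<in> ?R \<or> (\<exists>z. (x, z) \<in> ?R \<and> z \<in> W \<and> d v z = a)"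
        if "(x, w) \<in> (colour_rel d ?V a)\<^sup>*" for w
        using that
      proof (induction rule: rtrancl_induct)
        case base
        then show ?case using x by simp
      next
        case (step y z)
        have yz: "z \<in> ?V" "y \<noteq> z" "d y z = a"
          using step.hyps(2) by (auto simp: colour_rel_def)
        show ?case
        proof (cases "y \<in> W \<and> (x, y) \<in> ?R")
          case True
          show ?thesis
          proof (cases "z = v")
            case True
            then show ?thesis using yz \<open>y \<in> W \<and> (x, y) \<in> ?R\<close> sym[of v y] by auto
          next
            case False
            then have "(y, z) \<in> colour_rel d W a"
              using yz True by (auto simp: colour_rel_def)
            then show ?thesis
              using True yz False by (auto intro: rtrancl_into_rtrancl)
          qed
        next
          case False
          then show ?thesis using step.IH by blast
        qed
      qed
      from this[of v] show ?thesis using conn[OF aV] x insert.hyps(2) by blast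
    qed
    \<comment> \<open>In the triangle \<open>v x z\<close> only \<open>v z\<close> has colour
      \<open>a\<close>, so the other two edges agree; homogeneity then replaces \<open>z\<close> by
      \<open>y\<close>.\<close>
    have far: "d x y = d v x" if x: "x \<in> W" "d v x \<noteq> a" and y: "y \<in> W" "(x, y) \<notin> ?R" for x y
    proof -
      obtain z where z: "(y, z) \<in> ?R" "z \<in> W" "d v z = a"
        using attach[OF y(1)] by blast
      have xz: "(x, z) \<notin> ?R"
        using Rsym[OF z(1)] y(2) by (meson rtrancl_trans)
      then have "x \<noteq> z" by auto
      have "d x z \<noteq> a"
      proof
        assume "d x z = a"
        then have "(x, z) \<in> colour_rel d W a"
          using x(1) z(2) \<open>x \<noteq> z\<close> by (simp add: colour_rel_def)
        then show False using xz by blast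
      qed
      moreover have "v \<noteq> x" "v \<noteq> z"
        using x(1) z(2) insert.hyps(2) by blast+
      ultimately have "d x z = d v x"
        using rainbow_triangle_freeD[OF insert.prems(1), of v x z] x z(2,3) \<open>x \<noteq> z\<close>
        by (metis insertCI)
      moreover have "d y x = d z x"
        using colour_component_homogeneous[OF sym free z(1) y(1) x(1)] Rsym y(2) by blast
      ultimately show ?thesis by (metis sym)
    qed
    \<comment> \<open>Two vertices of one component are compared through a \<open>y\<close> outside
      it; vertices of different components through the edge \<open>x x'\<close>.\<close>
    have one: "d v x = d v x'"
      if x: "x \<in> W" "d v x \<noteq> a" and x': "x' \<in> W" "d v x' \<noteq> a" for x x'
    proof (cases "(x, x') \<in> ?R")
      case True
      obtain y where y: "y \<in> W" "(x, y) \<notin> ?R"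
        using a(2) Rsym by (meson rtrancl_trans)
      have "(x', y) \<notin> ?R" using True y(2) by (meson rtrancl_trans)
      then have "d v x = d x y" "d v x' = d x' y"
        using far x x' y by simp_all
      then show ?thesis
        using colour_component_homogeneous[OF sym free True x(1) y] by simp
    next
      case False
      then have "d x x' = d v x" "d x' x = d v x'"
        using far x x' Rsym by blast+
      then show ?thesis using sym[of x x'] by simp
    qed
    \<comment> \<open>By \<open>seen\<close> three distinct colours occur at \<open>v\<close>, and
      at least two of them differ from \<open>a\<close>, contrary to \<open>one\<close>.\<close>
    show False
      using seen[OF insert.prems(2)] seen[OF insert.prems(3)] seen[OF insert.prems(4)]
        insert.prems(5-7) one by metis
  qed
qed

text \<open>The parts are the fibres of \<open>p\<close>. With three colours some colour is
  disconnected, and contracting its components to representatives gives a smaller instance whose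
  partition is pulled back; with at most two colours the singletons will do.\<close>

theorem gallai_partition:
  assumes "finite V" and "card V \<ge> 2" and sym: "\<And>x y. d x y = d y x"
    and "rainbow_triangle_free d V"
  shows "\<exists>p :: 'a \<Rightarrow> 'a. \<exists>r b. (\<exists>x\<in>V. \<exists>y\<in>V. p x \<noteq> p y) \<and>
    (\<forall>x\<in>V. \<forall>y\<in>V. p x \<noteq> p y \<longrightarrow> d x y = r \<or> d x y = b) \<and>
    (\<forall>x\<in>V. \<forall>x'\<in>V. \<forall>y\<in>V. p x = p x' \<longrightarrow> p x \<noteq> p y \<longrightarrow> d x y = d x' y)"
  using assms(1,2,4)
proof (induction "card V" arbitrary: V rule: less_induct)
  case less
  show ?case
  proof (cases "\<exists>i j h. i \<noteq> j \<and> i \<noteq> h \<and> j \<noteq> h \<and> colour_rel d V i \<noteq> {} \<and>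
      colour_rel d V j \<noteq> {} \<and> colour_rel d V h \<noteq> {}")
    case True
    then obtain i where i: "colour_rel d V i \<noteq> {}"
        "\<exists>x\<in>V. \<exists>y\<in>V. (x, y) \<notin> (colour_rel d V i)\<^sup>*"
      using three_colours_disconnected[OF less.prems(1) sym less.prems(3)] by metis
    let ?R = "(colour_rel d V i)\<^sup>*"
    \<comment> \<open>The choice depends only on the component, so \<open>rep\<close> is constant on
      each component and separates different ones.\<close>
    define rep where "rep x = (SOME y. (x, y) \<in> ?R)" for x
    have rep: "(x, rep x) \<in> ?R" for x
      unfolding rep_def by (rule someI[of _ x]) simp
    have Rsym: "(y, x) \<in> ?R" if "(x, y) \<in> ?R" for x y
      using colour_rel_rtrancl_sym[OF sym that] .
    have rep_eq: "rep x = rep y \<longleftrightarrow> (x, y) \<in> ?R" for x y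
    proof
      assume "rep x = rep y"
      then show "(x, y) \<in> ?R"
        using rep[of x] Rsym[OF rep[of y]] by (metis rtrancl_trans)
    next
      assume xy: "(x, y) \<in> ?R"
      then have "(x, z) \<in> ?R \<longleftrightarrow> (y, z) \<in> ?R" for z
        using Rsym[OF xy] by (meson rtrancl_trans)
      then show "rep x = rep y" by (simp add: rep_def)
    qed
    have rep_mem: "rep x \<in> V" if "x \<in> V" for x
      using rep that colour_rel_rtrancl_mem by metis
    have d_rep: "d (rep x) (rep y) = d x y" if "x \<in> V" "y \<in> V" "rep x \<noteq> rep y" for x y
    proof -
      have "d x y = d (rep x) y"
        using colour_component_homogeneous[OF sym less.prems(3) rep] that rep_eq by blast
      moreover have "d y (rep x) = d (rep y) (rep x)"
      proof (rule colour_component_homogeneous[OF sym less.prems(3) rep that(2) rep_mem[OF that(1)]])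
        show "(y, rep x) \<notin> ?R"
          using that(3) rep_eq Rsym[OF rep] by (metis rtrancl_trans)
      qed
      ultimately show ?thesis by (metis sym)
    qed
    let ?T = "rep ` V"
    have sub: "?T \<subseteq> V" using rep_mem by blast
    \<comment> \<open>Colour \<open>i\<close> occurs, so two vertices share a representative and
      \<open>?T\<close> is smaller than \<open>V\<close>; colour \<open>i\<close> is disconnected,
      so at least two representatives remain.\<close>
    obtain x y where xy: "(x, y) \<in> colour_rel d V i" using i(1) by auto
    then have "\<not> inj_on rep V"
      using rep_eq unfolding inj_on_def colour_rel_def by blast
    then have lt: "card ?T < card V"
      using less.prems(1) by (metis card_image_le eq_card_imp_inj_on le_neq_implies_less)
    obtain u w where uw: "u \<in> V" "w \<in> V" "rep u \<noteq> rep w"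
      using i(2) rep_eq by blast
    have "card {rep u, rep w} \<le> card ?T"
      using uw less.prems(1) by (intro card_mono) auto
    then have "card ?T \<ge> 2" using uw(3) by simp
    from less.hyps[OF lt finite_imageI[OF less.prems(1)] this
        rainbow_triangle_free_subset[OF less.prems(3) sub]]
    obtain p :: "'a \<Rightarrow> 'a" and r b where p:
        "\<exists>x\<in>?T. \<exists>y\<in>?T. p x \<noteq> p y"
        "\<forall>x\<in>?T. \<forall>y\<in>?T. p x \<noteq> p y \<longrightarrow> d x y = r \<or> d x y = b"
        "\<forall>x\<in>?T. \<forall>x'\<in>?T. \<forall>y\<in>?T. p x = p x' \<longrightarrow> p x \<noteq> p y \<longrightarrow> d x y = d x' y"
      by blast
    have d_rep': "d (rep x) (rep y) = d x y"
      if "x \<in> V" "y \<in> V" "(p \<circ> rep) x \<noteq> (p \<circ> rep) y" for x y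
      using d_rep that by fastforce
    show ?thesis
    proof (rule exI[of _ "p \<circ> rep"], rule exI[of _ r], rule exI[of _ b],
        intro conjI ballI impI)
      show "\<exists>x\<in>V. \<exists>y\<in>V. (p \<circ> rep) x \<noteq> (p \<circ> rep) y" using p(1) by auto
      show "d x y = r \<or> d x y = b"
        if "x \<in> V" "y \<in> V" "(p \<circ> rep) x \<noteq> (p \<circ> rep) y" for x y
        using p(2) d_rep'[OF that] that by (metis comp_apply imageI)
      show "d x y = d x' y"
        if "x \<in> V" "x' \<in> V" "y \<in> V" "(p \<circ> rep) x = (p \<circ> rep) x'" "(p \<circ> rep) x \<noteq> (p \<circ> rep) y"
        for x x' y
      proof -
        have "d (rep x) (rep y) = d (rep x') (rep y)"
          using p(3) that by (metis comp_apply imageI)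
        then show ?thesis
          using d_rep'[of x y] d_rep'[of x' y] that by (metis (no_types))
      qed
    qed
  next
    case False
    have "\<exists>r b. \<forall>l. colour_rel d V l \<noteq> {} \<longrightarrow> l = r \<or> l = b"
    proof (cases "\<exists>r b. r \<noteq> b \<and> colour_rel d V r \<noteq> {} \<and> colour_rel d V b \<noteq> {}")
      case True
      then show ?thesis using False by blast
    next
      case False
      then show ?thesis by blast
    qed
    then obtain r b where used: "\<And>l. colour_rel d V l \<noteq> {} \<Longrightarrow> l = r \<or> l = b"
      by blast
    have rb: "d x y = r \<or> d x y = b" if "x \<in> V" "y \<in> V" "x \<noteq> y" for x y
    proof -
      have "(x, y) \<in> colour_rel d V (d x y)"
        using that by (simp add: colour_rel_def)
      then show ?thesis using used by blast
    qed
    obtain x y where xy: "x \<in> V" "y \<in> V" "x \<noteq> y"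
      using less.prems(2) by (metis One_nat_def Suc_1 card_le_Suc0_iff_eq less.prems(1) not_less_eq_eq)
    show ?thesis
      by (rule exI[of _ id], rule exI[of _ r], rule exI[of _ b]) (use rb xy in auto)
  qed
qed

section \<open>Upper bound\<close>

text \<open>The hypothesis says that the graph is a star forest: one end of each edge is a leaf.\<close>

lemma independent_half:
  assumes "finite A" and sym: "\<And>x y. E x y \<Longrightarrow> E y x"
    and "\<And>a b. a \<in> A \<Longrightarrow> b \<in> A \<Longrightarrow> a \<noteq> b \<Longrightarrow> E a b \<Longrightarrow>
      (\<forall>x\<in>A. x \<noteq> a \<longrightarrow> E a x \<longrightarrow> x = b) \<or> (\<forall>x\<in>A. x \<noteq> b \<longrightarrow> E b x \<longrightarrow> x = a)"
  shows "\<exists>I\<subseteq>A. card A \<le> 2 * card I \<and> (\<forall>x\<in>I. \<forall>y\<in>I. x \<noteq> y \<longrightarrow> \<not> E x y)"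
  using assms(1,3)
proof (induction "card A" arbitrary: A rule: less_induct)
  case less
  show ?case
  proof (cases "\<exists>a\<in>A. \<exists>b\<in>A. a \<noteq> b \<and> E a b")
    case False
    then show ?thesis by (intro exI[of _ A]) auto
  next
    case True
    then obtain u w where uw: "u \<in> A" "w \<in> A" "u \<noteq> w" "E u w" by blast
    \<comment> \<open>\<open>a\<close> is a leaf end of the edge: it joins the independent set, and
      deleting both ends removes its only neighbour \<open>b\<close>.\<close>
    obtain a b where ab: "a \<in> A" "b \<in> A" "a \<noteq> b" "\<forall>x\<in>A. x \<noteq> a \<longrightarrow> E a x \<longrightarrow> x = b"
      using less.prems(2)[OF uw] uw(1-3) by blast
    let ?B = "A - {a, b}"
    have "card {a, b} \<le> card A"
      using ab(1,2) less.prems(1) by (intro card_mono) simp_all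
    then have card: "card A = card ?B + 2"
      using ab(1-3) less.prems(1) by (simp add: card_Diff_subset)
    have "\<exists>I\<subseteq>?B. card ?B \<le> 2 * card I \<and> (\<forall>x\<in>I. \<forall>y\<in>I. x \<noteq> y \<longrightarrow> \<not> E x y)"
    proof (rule less.hyps)
      show "card ?B < card A" using card by simp
      show "finite ?B" using less.prems(1) by simp
      show "(\<forall>z\<in>?B. z \<noteq> x \<longrightarrow> E x z \<longrightarrow> z = y) \<or> (\<forall>z\<in>?B. z \<noteq> y \<longrightarrow> E y z \<longrightarrow> z = x)"
        if "x \<in> ?B" "y \<in> ?B" "x \<noteq> y" "E x y" for x y
        using less.prems(2)[of x y] that by blast
    qed
    then obtain I where I: "I \<subseteq> ?B" "card ?B \<le> 2 * card I"
        "\<forall>x\<in>I. \<forall>y\<in>I. x \<noteq> y \<longrightarrow> \<not> E x y"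
      by blast
    have "finite I" "a \<notin> I"
      using I(1) less.prems(1) finite_subset[of I A] by blast+
    then have "card A \<le> 2 * card (insert a I)"
      using I(2) card by simp
    moreover have "\<not> E a x" if "x \<in> I" for x
      using ab(4) that I(1) by blast
    then have "\<forall>x\<in>insert a I. \<forall>y\<in>insert a I. x \<noteq> y \<longrightarrow> \<not> E x y"
      using I(3) sym by blast
    ultimately show ?thesis
      using I(1) ab(1) by (intro exI[of _ "insert a I"]) blast
  qed
qed

text \<open>Used to choose one vertex from each Gallai part when all parts are small: the
  transversal then carries only the colours between parts.\<close>

lemma transversal_of_small_fibres:
  assumes "finite U" and "\<And>x. x \<in> U \<Longrightarrow> card {y\<in>U. p y = p x} \<le> m"
  shows "\<exists>T\<subseteq>U. inj_on p T \<and> card U \<le> m * card T"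
proof -
  obtain T where T: "T \<subseteq> U" "inj_on p T" "p ` U = p ` T"
    using subset_image_inj[of "p ` U" p U] by auto
  have "U = (\<Union>q\<in>p ` U. {y\<in>U. p y = q})" by auto
  then have "card U \<le> (\<Sum>q\<in>p ` U. card {y\<in>U. p y = q})"
    using assms(1) card_UN_le[of "p ` U" "\<lambda>q. {y\<in>U. p y = q}"] by simp
  also have "\<dots> \<le> (\<Sum>q\<in>p ` U. m)"
    using assms(2) by (intro sum_mono) auto
  also have "\<dots> = m * card T"
    using T by (simp add: card_image)
  finally show ?thesis using T by blast
qed

section \<open>Arithmetic of the claimed extremal order\<close>

definition extremal_order :: "nat \<Rightarrow> nat" where
  "extremal_order k = (if even k then 9 * 5 ^ ((k - 2) div 2) else 4 * 5 ^ ((k - 1) div 2))"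

lemma extremal_order_1: "extremal_order (Suc 0) = 4"
  and extremal_order_2: "extremal_order (Suc (Suc 0)) = 9"
  by (simp_all add: extremal_order_def)

lemma extremal_order_add_2:
  assumes "k \<ge> 1"
  shows "extremal_order (Suc (Suc k)) = 5 * extremal_order k"
proof (cases "even k")
  case True
  then obtain m where "k = 2 * m" by (elim evenE)
  with assms obtain n where "k = 2 * Suc n" by (cases m) auto
  then show ?thesis by (simp add: extremal_order_def)
next
  case False
  then obtain m where "k = 2 * m + 1" by (elim oddE)
  then show ?thesis by (simp add: extremal_order_def)
qed

lemma extremal_order_ge_4: "extremal_order k \<ge> 4"
proof -
  have "(5::nat) ^ n \<ge> 1" for n by simp
  from this[of "(k - 2) div 2"] this[of "(k - 1) div 2"] show ?thesis
    unfolding extremal_order_def by presburger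
qed

text \<open>The slack that pays for dropping one colour at the price of a factor 2 and two leftover
  vertices. For \<open>k = 1\<close> it fails (10 > 9), so two colours need a base case of their
  own.\<close>

lemma extremal_order_Suc_ge:
  assumes "k \<ge> 2"
  shows "2 * extremal_order k + 2 \<le> extremal_order (Suc k)"
proof (cases "even k")
  case True
  then obtain m where "k = 2 * m" by (elim evenE)
  with assms obtain n where "k = 2 * Suc n" by (cases m) auto
  then have "extremal_order k = 9 * 5 ^ n" "extremal_order (Suc k) = 20 * 5 ^ n"
    by (simp_all add: extremal_order_def)
  then show ?thesis using one_le_power[of "5::nat" n] by linarith
next
  case False
  then obtain m where "k = 2 * m + 1" by (elim oddE)
  with assms obtain n where "k = 2 * Suc n + 1" by (cases m) auto
  then have "extremal_order k = 20 * 5 ^ n" "extremal_order (Suc k) = 45 * 5 ^ n"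
    by (simp_all add: extremal_order_def)
  then show ?thesis using one_le_power[of "5::nat" n] by linarith
qed

text \<open>The only consequences of forbidding \<open>F\<^sub>1\<^sub>2\<close>, respectively \<open>F\<^sub>1\<^sub>3\<close>, that the induction needs; this treats
  both graphs at once.\<close>

locale sparse_colouring =
  fixes d :: "'a \<Rightarrow> 'a \<Rightarrow> nat" and V :: "'a set"
  assumes finite_V: "finite V"
    and sym: "d x y = d y x"
    and free: "rainbow_triangle_free d V"
    and star: "\<lbrakk>v \<in> V; A \<subseteq> V; v \<notin> A; card A \<ge> 4; \<forall>a\<in>A. d v a = i;
      a \<in> A; b \<in> A; a \<noteq> b; d a b = i\<rbrakk> \<Longrightarrow>
      (\<forall>x\<in>A. x \<noteq> a \<longrightarrow> d a x = i \<longrightarrow> x = b) \<or> (\<forall>x\<in>A. x \<noteq> b \<longrightarrow> d b x = i \<longrightarrow> x = a)"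
    and complete_pair: "\<lbrakk>A \<subseteq> V; C \<subseteq> V; A \<inter> C = {}; card A \<ge> 3; card C \<ge> 3;
      \<forall>a\<in>A. \<forall>c\<in>C. d a c = i; a \<in> A; a' \<in> A; a \<noteq> a'\<rbrakk> \<Longrightarrow> d a a' \<noteq> i"
    and two_colours: "\<lbrakk>A \<subseteq> V; \<forall>x\<in>A. \<forall>y\<in>A. x \<noteq> y \<longrightarrow> d x y = i \<or> d x y = j\<rbrakk> \<Longrightarrow> card A \<le> 9"
begin

section \<open>Induction on the number of colours\<close>

lemma half_avoiding:
  assumes "v \<in> V" "A \<subseteq> V" "v \<notin> A" "card A \<ge> 4" "\<forall>a\<in>A. d v a = i"
  shows "\<exists>I\<subseteq>A. card A \<le> 2 * card I \<and> (\<forall>x\<in>I. \<forall>y\<in>I. x \<noteq> y \<longrightarrow> d x y \<noteq> i)"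
proof (rule independent_half)
  show "finite A" using assms(2) finite_V finite_subset by blast
  show "d y x = i" if "d x y = i" for x y using that sym[of x y] by simp
  show "(\<forall>x\<in>A. x \<noteq> a \<longrightarrow> d a x = i \<longrightarrow> x = b) \<or> (\<forall>x\<in>A. x \<noteq> b \<longrightarrow> d b x = i \<longrightarrow> x = a)"
    if "a \<in> A" "b \<in> A" "a \<noteq> b" "d a b = i" for a b
    by (rule star[OF assms that])
qed

text \<open>With five vertices, half of the at least four neighbours of \<open>v\<close> would avoid
  the colour, yet any two vertices span an edge in it.\<close>

lemma one_colour:
  assumes "A \<subseteq> V" "\<forall>x\<in>A. \<forall>y\<in>A. x \<noteq> y \<longrightarrow> d x y = i"
  shows "card A \<le> 4"
proof (rule ccontr)
  assume "\<not> card A \<le> 4"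
  then obtain v where v: "v \<in> A" by fastforce
  let ?B = "A - {v}"
  have "card ?B \<ge> 4" using \<open>\<not> card A \<le> 4\<close> v by simp
  moreover have "\<forall>a\<in>?B. d v a = i" using v assms(2) by auto
  moreover have "v \<in> V" "?B \<subseteq> V" "v \<notin> ?B" using v assms(1) by blast+
  ultimately obtain I where I: "I \<subseteq> ?B" "card ?B \<le> 2 * card I"
      "\<forall>x\<in>I. \<forall>y\<in>I. x \<noteq> y \<longrightarrow> d x y \<noteq> i"
    using half_avoiding[of v ?B i] by blast
  have "card I \<ge> 2" using I(2) \<open>card ?B \<ge> 4\<close> by simp
  then have "\<not> card I \<le> 1" by simp
  moreover have "finite I"
    using I(1) assms(1) finite_V by (meson Diff_subset finite_subset)
  ultimately obtain x y where "x \<in> I" "y \<in> I" "x \<noteq> y"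
    by (auto simp: card_le_Suc0_iff_eq)
  then show False using I(1,3) assms(2) by blast
qed

text \<open>\<open>W\<close> and the colour set \<open>S\<close> are arbitrary so that the induction
  can delete any colours from \<open>S\<close>.\<close>

theorem card_le_extremal_order:
  assumes "W \<subseteq> V" "\<forall>x\<in>W. \<forall>y\<in>W. x \<noteq> y \<longrightarrow> d x y \<in> S" "finite S" "card S = k" "k \<ge> 1"
  shows "card W \<le> extremal_order k"
  using assms
proof (induction k arbitrary: W S rule: less_induct)
  case (less k)
  consider "k = 1" | "k = 2" | "k \<ge> 3" using less.prems(5) by linarith
  then show ?case
  proof cases
    case 1
    then obtain i where "S = {i}" using less.prems(4) by (auto simp: card_1_singleton_iff)
    then show ?thesis
      using one_colour[of W i] less.prems(1,2) 1 by (auto simp: extremal_order_1)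
  next
    case 2
    then obtain i j where "S = {i, j}" using less.prems(4) by (auto simp: card_2_iff)
    then show ?thesis
      using two_colours[of W i j] less.prems(1,2) 2 by (auto simp: extremal_order_2 numeral_2_eq_2)
  next
    case 3
    \<comment> \<open>\<open>c\<close> is the bound to be shown; \<open>b1\<close> and
      \<open>a\<close> are the bounds for sets that avoid one, respectively two, of the colours in
      \<open>S\<close>.\<close>
    define a where "a = extremal_order (k - 2)"
    define b1 where "b1 = extremal_order (k - 1)"
    define c where "c = extremal_order k"
    have c: "c = 5 * a"
      using 3 extremal_order_add_2[of "k - 2"] by (simp add: a_def c_def Suc_diff_Suc numeral_2_eq_2)
    have b1: "2 * b1 + 2 \<le> c"
      using 3 extremal_order_Suc_ge[of "k - 1"] by (simp add: b1_def c_def)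
    have a4: "a \<ge> 4" unfolding a_def by (rule extremal_order_ge_4)
    have finW: "finite W" using less.prems(1) finite_V finite_subset by blast
    have avoid1: "card U \<le> b1"
      if "U \<subseteq> W" "i \<in> S" "\<forall>x\<in>U. \<forall>y\<in>U. x \<noteq> y \<longrightarrow> d x y \<noteq> i" for U i
      unfolding b1_def
    proof (rule less.IH)
      show "k - 1 < k" "k - 1 \<ge> 1" using 3 by simp_all
      show "U \<subseteq> V" using that(1) less.prems(1) by blast
      show "\<forall>x\<in>U. \<forall>y\<in>U. x \<noteq> y \<longrightarrow> d x y \<in> S - {i}"
        using that(1,3) less.prems(2) by blast
      show "finite (S - {i})" "card (S - {i}) = k - 1"
        using that(2) less.prems(3,4) by simp_all
    qed
    have avoid2: "card U \<le> a"
      if "U \<subseteq> W" "i \<in> S" "j \<in> S" "i \<noteq> j"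
        "\<forall>x\<in>U. \<forall>y\<in>U. x \<noteq> y \<longrightarrow> d x y \<noteq> i" "\<forall>x\<in>U. \<forall>y\<in>U. x \<noteq> y \<longrightarrow> d x y \<noteq> j" for U i j
      unfolding a_def
    proof (rule less.IH)
      show "k - 2 < k" "k - 2 \<ge> 1" using 3 by simp_all
      show "U \<subseteq> V" using that(1) less.prems(1) by blast
      show "\<forall>x\<in>U. \<forall>y\<in>U. x \<noteq> y \<longrightarrow> d x y \<in> S - {i, j}"
        using that(1,5,6) less.prems(2) by blast
      show "finite (S - {i, j})" "card (S - {i, j}) = k - 2"
        using that(2-4) less.prems(3,4) by (simp_all add: card_Diff_subset)
    qed
    have "card W \<le> c"
    proof (rule ccontr)
      assume "\<not> card W \<le> c"
      then have large: "card W > c" by simp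
      then have "card W \<ge> 2" using c a4 by simp
      from gallai_partition[OF finW this sym rainbow_triangle_free_subset[OF free less.prems(1)]]
      obtain p :: "'a \<Rightarrow> 'a" and r b where gp:
          "\<exists>x\<in>W. \<exists>y\<in>W. p x \<noteq> p y"
          "\<forall>x\<in>W. \<forall>y\<in>W. p x \<noteq> p y \<longrightarrow> d x y = r \<or> d x y = b"
          "\<forall>x\<in>W. \<forall>x'\<in>W. \<forall>y\<in>W. p x = p x' \<longrightarrow> p x \<noteq> p y \<longrightarrow> d x y = d x' y"
        by blast
      have cross: "d x y = r \<or> d x y = b" if "x \<in> W" "y \<in> W" "p x \<noteq> p y" for x y
        using gp(2) that by blast
      have hom: "d x y = d x' y"
        if "x \<in> W" "x' \<in> W" "y \<in> W" "p x = p x'" "p x \<noteq> p y" for x x' y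
        using gp(3) that by blast
      define part where "part x = {y\<in>W. p y = p x}" for x
      \<comment> \<open>The red and blue neighbourhoods of the part of \<open>x\<close>. Blue is
        defined as not red, so that with the part they split \<open>W\<close> even if
        \<open>r = b\<close>.\<close>
      define R where "R x = {y\<in>W. p y \<noteq> p x \<and> d x y = r}" for x
      define B where "B x = {y\<in>W. p y \<noteq> p x \<and> d x y \<noteq> r}" for x
      have sub: "part x \<subseteq> W" "R x \<subseteq> W" "B x \<subseteq> W" for x
        by (auto simp: part_def R_def B_def)
      have disj: "part x \<inter> R x = {}" "part x \<inter> B x = {}" for x
        by (auto simp: part_def R_def B_def)
      have "W = part x \<union> (R x \<union> B x)" for x
        by (auto simp: part_def R_def B_def)
      then have cardW: "card W \<le> card (part x) + card (R x) + card (B x)" for x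
        using card_Un_le[of "part x" "R x \<union> B x"] card_Un_le[of "R x" "B x"]
        by (metis add.assoc add_le_cancel_left order_trans)
      have toR: "\<forall>u\<in>part x. \<forall>y\<in>R x. d u y = r" if "x \<in> W" for x
      proof (intro ballI)
        fix u y
        assume "u \<in> part x" "y \<in> R x"
        then show "d u y = r"
          using hom[of x u y] that by (auto simp: part_def R_def)
      qed
      have toB: "\<forall>u\<in>part x. \<forall>y\<in>B x. d u y = b" if "x \<in> W" for x
      proof (intro ballI)
        fix u y
        assume "u \<in> part x" "y \<in> B x"
        then show "d u y = b"
          using hom[of x u y] cross[of x y] that by (auto simp: part_def B_def)
      qed
      have rS: "r \<in> S" if x: "x \<in> W" and ne: "R x \<noteq> {}" for x
      proof -
        obtain y where "y \<in> R x" using ne by blast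
        then have "y \<in> W" "x \<noteq> y" "d x y = r" by (auto simp: R_def)
        then show ?thesis using x less.prems(2) by blast
      qed
      have bS: "b \<in> S \<and> r \<noteq> b" if x: "x \<in> W" and ne: "B x \<noteq> {}" for x
      proof -
        obtain y where "y \<in> B x" using ne by blast
        then have y: "y \<in> W" "p x \<noteq> p y" "d x y \<noteq> r" by (auto simp: B_def)
        then have "d x y = b" "x \<noteq> y" using cross[of x y] x by auto
        then show ?thesis using y x less.prems(2) by blast
      qed
      have avoid: "(\<forall>u\<in>A. \<forall>y\<in>A. u \<noteq> y \<longrightarrow> d u y \<noteq> i) \<and> (\<forall>u\<in>N. \<forall>y\<in>N. u \<noteq> y \<longrightarrow> d u y \<noteq> i)"
        if "A \<subseteq> W" "N \<subseteq> W" "A \<inter> N = {}" "card A \<ge> 3" "card N \<ge> 3" "\<forall>u\<in>A. \<forall>y\<in>N. d u y = i"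
        for A N i
      proof -
        have NA: "\<forall>y\<in>N. \<forall>u\<in>A. d y u = i"
        proof (intro ballI)
          show "d y u = i" if "y \<in> N" "u \<in> A" for y u
            using \<open>\<forall>u\<in>A. \<forall>y\<in>N. d u y = i\<close> that sym[of y u] by simp
        qed
        have V: "A \<subseteq> V" "N \<subseteq> V" and "N \<inter> A = {}"
          using that(1-3) less.prems(1) by blast+
        then show ?thesis
          using complete_pair[OF V that(3-6)] complete_pair[OF V(2,1) _ that(5,4) NA] by blast
      qed
      have avoidR: "(\<forall>u\<in>part x. \<forall>y\<in>part x. u \<noteq> y \<longrightarrow> d u y \<noteq> r) \<and>
          (\<forall>u\<in>R x. \<forall>y\<in>R x. u \<noteq> y \<longrightarrow> d u y \<noteq> r)"
        if "x \<in> W" "card (part x) \<ge> 3" "card (R x) \<ge> 3" for x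
        using avoid[OF sub(1,2) disj(1) that(2,3) toR[OF that(1)]] .
      have avoidB: "(\<forall>u\<in>part x. \<forall>y\<in>part x. u \<noteq> y \<longrightarrow> d u y \<noteq> b) \<and>
          (\<forall>u\<in>B x. \<forall>y\<in>B x. u \<noteq> y \<longrightarrow> d u y \<noteq> b)"
        if "x \<in> W" "card (part x) \<ge> 3" "card (B x) \<ge> 3" for x
        using avoid[OF sub(1,3) disj(2) that(2,3) toB[OF that(1)]] .
      \<comment> \<open>A part with at least three vertices must have two large neighbourhoods;
        otherwise \<open>W\<close> is too small.\<close>
      have both: "card (R x) \<ge> 3 \<and> card (B x) \<ge> 3" if x: "x \<in> W" and big: "card (part x) \<ge> 3" for x
      proof (rule ccontr)
        assume not_both: "\<not> ?thesis"
        \<comment> \<open>Only one neighbourhood \<open>N\<close> is large: the part and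
          \<open>N\<close> both avoid the joining colour, which gives at most
          \<open>2 * b1 + 2\<close> vertices, hence at most \<open>c\<close>.\<close>
        have split: "False"
          if "card N \<ge> 3" "N \<subseteq> W" "i \<in> S" "card W \<le> card (part x) + card N + 2"
            "(\<forall>u\<in>part x. \<forall>y\<in>part x. u \<noteq> y \<longrightarrow> d u y \<noteq> i) \<and> (\<forall>u\<in>N. \<forall>y\<in>N. u \<noteq> y \<longrightarrow> d u y \<noteq> i)"
          for N i
        proof -
          have "card (part x) \<le> b1" "card N \<le> b1"
            using avoid1[OF sub(1)] avoid1[OF that(2)] that(3,5) by blast+
          then show False using that(4) large b1 by simp
        qed
        have half: "\<exists>I\<subseteq>U. card U \<le> 2 * card I \<and> (\<forall>u\<in>I. \<forall>y\<in>I. u \<noteq> y \<longrightarrow> d u y \<noteq> i)"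
          if "v \<in> W" "U \<subseteq> part x" "v \<notin> part x" "card U \<ge> 4" "\<forall>u\<in>part x. d u v = i" for v U i
        proof (rule half_avoiding[OF _ _ _ that(4)])
          show "v \<in> V" "U \<subseteq> V" "v \<notin> U"
            using that(1-3) sub(1)[of x] less.prems(1) by blast+
          show "\<forall>u\<in>U. d v u = i"
          proof
            show "d v u = i" if "u \<in> U" for u
              using \<open>\<forall>u\<in>part x. d u v = i\<close> \<open>U \<subseteq> part x\<close> that sym[of v u] by auto
          qed
        qed
        have small: "card (R x) \<le> 2 \<and> card (B x) \<le> 2"
        proof (rule ccontr)
          assume "\<not> ?thesis"
          then consider "card (R x) \<ge> 3" "card (B x) \<le> 2" | "card (B x) \<ge> 3" "card (R x) \<le> 2"
            using not_both by linarith
          then show False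
          proof cases
            case 1
            then have "R x \<noteq> {}" by auto
            then show False
              using split[OF 1(1) sub(2) rS[OF x]] avoidR[OF x big 1(1)] cardW[of x] 1(2) by simp
          next
            case 2
            then have "B x \<noteq> {}" by auto
            then show False
              using split[OF 2(1) sub(3), of b] bS[OF x] avoidB[OF x big 2(1)] cardW[of x] 2(2)
              by simp
          qed
        qed
        \<comment> \<open>Both neighbourhoods have at most 2 vertices, and \<open>c\<close> is at
          least 20. Sixteen vertices leave eight after one halving, still enough to apply
          \<open>half_avoiding\<close> again.\<close>
        then have part16: "card (part x) \<ge> 16"
          using cardW[of x] large c a4 by simp
        have single: "card (part x) \<le> 2 * b1"
          if v: "v \<in> W" "v \<notin> part x" "\<forall>u\<in>part x. d u v = i" and "i \<in> S" for v i
        proof -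
          obtain I where "I \<subseteq> part x" "card (part x) \<le> 2 * card I"
              "\<forall>u\<in>I. \<forall>y\<in>I. u \<noteq> y \<longrightarrow> d u y \<noteq> i"
            using half[of v "part x" i] v part16 by auto
          moreover from this(1) have "I \<subseteq> W" using sub(1)[of x] by blast
          ultimately show ?thesis using avoid1[of I i] \<open>i \<in> S\<close> by simp
        qed
        \<comment> \<open>With both neighbourhoods empty there would be a single part; one nonempty
          neighbourhood permits one halving, two permit two.\<close>
        consider "R x = {}" "B x = {}" | v where "R x = {}" "v \<in> B x" | v where "v \<in> R x" "B x = {}"
          | v w where "v \<in> R x" "w \<in> B x" by blast
        then show False
        proof cases
          case 1
          then have "p y = p x" if "y \<in> W" for y
            using that by (auto simp: R_def B_def)
          then show False using gp(1) by auto
        next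
          case 2
          then have "card (part x) \<le> 2 * b1"
            using single[of v b] toB[OF x] bS[OF x] sub(3) disj(2) by blast
          then show False using 2(1) small cardW[of x] large b1 by simp
        next
          case 3
          then have "card (part x) \<le> 2 * b1"
            using single[of v r] toR[OF x] rS[OF x] sub(2) disj(1) by blast
          then show False using 3(2) small cardW[of x] large b1 by simp
        next
          case 4
          have v: "v \<in> W" "v \<notin> part x" "\<forall>u\<in>part x. d u v = r"
            using 4(1) toR[OF x] sub(2) disj(1) by blast+
          have w: "w \<in> W" "w \<notin> part x" "\<forall>u\<in>part x. d u w = b"
            using 4(2) toB[OF x] sub(3) disj(2) by blast+
          obtain I where I: "I \<subseteq> part x" "card (part x) \<le> 2 * card I"
              "\<forall>u\<in>I. \<forall>y\<in>I. u \<noteq> y \<longrightarrow> d u y \<noteq> r"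
            using half[of v "part x" r] v part16 by auto
          obtain J where J: "J \<subseteq> I" "card I \<le> 2 * card J"
              "\<forall>u\<in>J. \<forall>y\<in>J. u \<noteq> y \<longrightarrow> d u y \<noteq> b"
            using half[of w I b] w I(1,2) part16 by auto
          have "card J \<le> a"
          proof (rule avoid2)
            show "J \<subseteq> W" using J(1) I(1) sub(1) by blast
            show "r \<in> S" "b \<in> S" "r \<noteq> b" using rS[OF x] bS[OF x] 4 by blast+
            show "\<forall>u\<in>J. \<forall>y\<in>J. u \<noteq> y \<longrightarrow> d u y \<noteq> r" using I(3) J(1) by blast
            show "\<forall>u\<in>J. \<forall>y\<in>J. u \<noteq> y \<longrightarrow> d u y \<noteq> b" by (rule J(3))
          qed
          \<comment> \<open>Two halvings bound the part by \<open>4 * a\<close>, so \<open>W\<close>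
            has at most \<open>4 * a + 4\<close> vertices; this is at most \<open>5 * a\<close>
            because \<open>a \<ge> 4\<close>.\<close>
          then show False using I(2) J(2) small cardW[of x] large c a4 by simp
        qed
      qed
      show False
      proof (cases "\<forall>x\<in>W. card (part x) \<le> 2")
        \<comment> \<open>All parts are small: a transversal carries only two colours, so
          \<open>W\<close> has at most 2 * 9 = 18 vertices, while \<open>c\<close> is at least
          20.\<close>
        case True
        then obtain T where T: "T \<subseteq> W" "inj_on p T" "card W \<le> 2 * card T"
          using transversal_of_small_fibres[of W p 2] finW unfolding part_def by blast
        have "\<forall>x\<in>T. \<forall>y\<in>T. x \<noteq> y \<longrightarrow> d x y = r \<or> d x y = b"
          using T(1,2) cross by (meson inj_onD subsetD)
        then have "card T \<le> 9"
          using two_colours[of T r b] T(1) less.prems(1) by (meson subset_trans)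
        then show False using T(3) large c a4 by simp
      next
        case False
        then obtain x where x: "x \<in> W" and big: "card (part x) \<ge> 3" by fastforce
        then have RB: "card (R x) \<ge> 3" "card (B x) \<ge> 3" using both by blast+
        then have "R x \<noteq> {}" "B x \<noteq> {}" by auto
        then have cols: "r \<in> S" "b \<in> S" "r \<noteq> b" using rS[OF x] bS[OF x] by auto
        have part_le: "card (part z) \<le> a" if "z \<in> W" "card (part z) \<ge> 3" for z
          using avoid2[OF sub(1) cols] avoidR[OF that] avoidB[OF that] both[OF that] by blast
        \<comment> \<open>If \<open>N\<close> meets every part in at most two vertices, a
          transversal uses only \<open>j\<close> and has at most 4 vertices. Otherwise a large piece
          \<open>C\<close> of a part has at most \<open>a\<close> vertices, and the rest of
          \<open>N\<close>, joined to \<open>C\<close> in \<open>j\<close>, is tiny or avoids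
          \<open>j\<close> as well as \<open>i\<close>.\<close>
        have nbhd_le: "card N \<le> 2 * a"
          if N: "N \<subseteq> W" and ij: "i \<in> S" "j \<in> S" "i \<noteq> j"
            and no_i: "\<forall>u\<in>N. \<forall>y\<in>N. u \<noteq> y \<longrightarrow> d u y \<noteq> i"
            and only_j: "\<And>u y. u \<in> N \<Longrightarrow> y \<in> N \<Longrightarrow> p u \<noteq> p y \<Longrightarrow> d u y = j" for N i j
        proof (cases "\<forall>z\<in>N. card {y\<in>N. p y = p z} \<le> 2")
          case True
          then obtain T where T: "T \<subseteq> N" "inj_on p T" "card N \<le> 2 * card T"
            using transversal_of_small_fibres[of N p 2] finite_subset[OF N finW] by blast
          have "\<forall>x\<in>T. \<forall>y\<in>T. x \<noteq> y \<longrightarrow> d x y = j"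
            using T(1,2) only_j by (meson inj_onD subsetD)
          then have "card T \<le> 4"
            using one_colour[of T j] T(1) N less.prems(1) by (meson subset_trans)
          then show ?thesis using T(3) a4 by simp
        next
          case False
          then obtain z where z: "z \<in> N" "\<not> card {y\<in>N. p y = p z} \<le> 2" by blast
          define C where "C = {y\<in>N. p y = p z}"
          have C: "C \<subseteq> part z" "C \<subseteq> N" using N by (auto simp: C_def part_def)
          have C3: "card C \<ge> 3" using z(2) by (simp add: C_def)
          have "card C \<le> card (part z)"
            using C(1) finite_subset[OF sub(1) finW] by (rule card_mono[rotated])
          then have "card C \<le> a" using part_le[of z] z(1) N C3 by force
          moreover have "card (N - C) \<le> a"
          proof (cases "card (N - C) \<ge> 3")
            case True
            have "\<forall>u\<in>C. \<forall>y\<in>N - C. d u y = j"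
            proof (intro ballI)
              show "d u y = j" if "u \<in> C" "y \<in> N - C" for u y
                using only_j[of u y] that by (auto simp: C_def)
            qed
            then have "\<forall>u\<in>N - C. \<forall>y\<in>N - C. u \<noteq> y \<longrightarrow> d u y \<noteq> j"
              using avoid[of C "N - C" j] C(2) N C3 True by blast
            then show ?thesis
              using avoid2[of "N - C" i j] N ij no_i by blast
          next
            case False
            then show ?thesis using a4 by simp
          qed
          moreover have "card N = card C + card (N - C)"
            using C(2) finite_subset[OF N finW]
            by (metis card_Diff_subset card_mono finite_subset le_add_diff_inverse)
          ultimately show ?thesis by simp
        qed
        have "card (R x) \<le> 2 * a"
        proof (rule nbhd_le[OF sub(2) cols])
          show noR: "\<forall>u\<in>R x. \<forall>y\<in>R x. u \<noteq> y \<longrightarrow> d u y \<noteq> r"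
            using avoidR[OF x big RB(1)] by blast
          show "d u y = b" if "u \<in> R x" "y \<in> R x" "p u \<noteq> p y" for u y
          proof -
            have "u \<in> W" "y \<in> W" "u \<noteq> y" using that sub(2) by auto
            then show ?thesis using noR that cross[of u y] by auto
          qed
        qed
        moreover have "card (B x) \<le> 2 * a"
        proof (rule nbhd_le[OF sub(3) cols(2,1) cols(3)[symmetric]])
          show noB: "\<forall>u\<in>B x. \<forall>y\<in>B x. u \<noteq> y \<longrightarrow> d u y \<noteq> b"
            using avoidB[OF x big RB(2)] by blast
          show "d u y = r" if "u \<in> B x" "y \<in> B x" "p u \<noteq> p y" for u y
          proof -
            have "u \<in> W" "y \<in> W" "u \<noteq> y" using that sub(3) by auto
            then show ?thesis using noB that cross[of u y] by auto
          qed
        qed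
        moreover have "card (part x) \<le> a" by (rule part_le[OF x big])
        ultimately show False using cardW[of x] large c by simp
      qed
    qed
    then show ?thesis by (simp add: c_def)
  qed
qed

end

section \<open>The forbidden graphs as patterns on five vertices\<close>

definition has_F12 :: "('a \<Rightarrow> 'a \<Rightarrow> nat) \<Rightarrow> 'a set \<Rightarrow> bool" where
  "has_F12 d V \<longleftrightarrow> (\<exists>u x y z w i. {u, x, y, z, w} \<subseteq> V \<and> distinct [u, x, y, z, w] \<and>
     d u x = i \<and> d u y = i \<and> d u z = i \<and> d x y = i \<and> d y z = i \<and> d u w = i)"

definition has_F13 :: "('a \<Rightarrow> 'a \<Rightarrow> nat) \<Rightarrow> 'a set \<Rightarrow> bool" where
  "has_F13 d V \<longleftrightarrow> (\<exists>u v x y z i. {u, v, x, y, z} \<subseteq> V \<and> distinct [u, v, x, y, z] \<and>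
     d u x = i \<and> d u y = i \<and> d v x = i \<and> d v y = i \<and> d x y = i \<and> d u z = i)"

lemma has_F12I:
  assumes "{u, x, y, z, w} \<subseteq> V" "distinct [u, x, y, z, w]"
    "d u x = i" "d u y = i" "d u z = i" "d x y = i" "d y z = i" "d u w = i"
  shows "has_F12 d V"
  unfolding has_F12_def using assms by blast

lemma has_F13I:
  assumes "{u, v, x, y, z} \<subseteq> V" "distinct [u, v, x, y, z]"
    "d u x = i" "d u y = i" "d v x = i" "d v y = i" "d x y = i" "d u z = i"
  shows "has_F13 d V"
  unfolding has_F13_def using assms by blast

lemma has_F12E:
  assumes "has_F12 d V"
  obtains u x y z w i where "{u, x, y, z, w} \<subseteq> V" "distinct [u, x, y, z, w]"
    "d u x = i" "d u y = i" "d u z = i" "d x y = i" "d y z = i" "d u w = i"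
  using assms unfolding has_F12_def by (elim exE conjE) (rule that)

lemma has_F13E:
  assumes "has_F13 d V"
  obtains u v x y z i where "{u, v, x, y, z} \<subseteq> V" "distinct [u, v, x, y, z]"
    "d u x = i" "d u y = i" "d v x = i" "d v y = i" "d x y = i" "d u z = i"
  using assms unfolding has_F13_def by (elim exE conjE) (rule that)

lemma has_F12_mono: "has_F12 d A \<Longrightarrow> A \<subseteq> B \<Longrightarrow> has_F12 d B"
  unfolding has_F12_def by (meson subset_trans)

lemma has_F13_mono: "has_F13 d A \<Longrightarrow> A \<subseteq> B \<Longrightarrow> has_F13 d B"
  unfolding has_F13_def by (meson subset_trans)

section \<open>Colourings without monochromatic \<open>F12\<close> or \<open>F13\<close> are
  sparse\<close>

lemma obtain_fresh:
  assumes "length xs < card A"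
  obtains w where "w \<in> A" "w \<notin> set xs"
proof -
  have "\<not> A \<subseteq> set xs"
    using assms card_mono[of "set xs" A] card_length[of xs] by auto
  then show ?thesis using that by blast
qed

lemma obtain_distinct_list:
  assumes "n \<le> card A"
  obtains xs where "length xs = n" "distinct xs" "set xs \<subseteq> A"
proof -
  obtain T where T: "T \<subseteq> A" "card T = n" "finite T"
    using assms by (metis obtain_subset_with_card_n)
  then obtain xs where "set xs = T" "distinct xs"
    using finite_distinct_list by blast
  then show ?thesis using T that distinct_card by metis
qed

text \<open>At least nine further vertices share two colours, so one colour occurs at
  \<open>v\<close> at least five times. \<open>i'\<close> and \<open>j'\<close> are \<open>i\<close>
  and \<open>j\<close> in a suitable order.\<close>

lemma two_coloured_neighbourhood:
  assumes "A \<subseteq> V" "finite A" "card A \<ge> 10" "v \<in> A"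
    and "\<forall>x\<in>A. \<forall>y\<in>A. x \<noteq> y \<longrightarrow> d x y = i \<or> d x y = j"
  obtains R i' j' where "R \<subseteq> A - {v}" "card R = 5" "\<forall>x\<in>R. d v x = i'"
    "\<forall>x\<in>A. \<forall>y\<in>A. x \<noteq> y \<longrightarrow> d x y = i' \<or> d x y = j'"
proof -
  define P where "P = {x\<in>A - {v}. d v x = i}"
  define Q where "Q = {x\<in>A - {v}. d v x = j}"
  have "A - {v} \<subseteq> P \<union> Q"
    using assms(4,5) by (auto simp: P_def Q_def)
  then have "card (A - {v}) \<le> card P + card Q"
    using assms(2) card_mono[of "P \<union> Q" "A - {v}"] card_Un_le[of P Q]
    by (simp add: P_def Q_def)
  then consider "card P \<ge> 5" | "card Q \<ge> 5"
    using assms(2-4) by fastforce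
  then show ?thesis
  proof cases
    case 1
    then obtain R where "R \<subseteq> P" "card R = 5" by (metis obtain_subset_with_card_n)
    then show ?thesis using assms(5) by (intro that[of R i j]) (auto simp: P_def)
  next
    case 2
    then obtain R where "R \<subseteq> Q" "card R = 5" by (metis obtain_subset_with_card_n)
    then show ?thesis using assms(5) by (intro that[of R j i]) (auto simp: Q_def)
  qed
qed

text \<open>Two edges of colour \<open>i\<close> at \<open>a\<close> inside \<open>A\<close>,
  together with \<open>v\<close> and a fourth vertex of \<open>A\<close> as pendant, would form
  \<open>F12\<close> with \<open>v\<close> in the role of \<open>u\<close>. So colour
  \<open>i\<close> is a matching on \<open>A\<close>, which is more than the required star
  forest.\<close>

lemma F12_free_neighbourhood:
  assumes "\<And>x y. d x y = d y x" "\<not> has_F12 d V"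
    and "v \<in> V" "A \<subseteq> V" "v \<notin> A" and A4: "card A \<ge> 4" and "\<forall>a\<in>A. d v a = i"
    and "a \<in> A" "b \<in> A" "a \<noteq> b" "d a b = i" "x \<in> A" "x \<noteq> a" "d a x = i"
  shows "x = b"
proof (rule ccontr)
  assume "x \<noteq> b"
  obtain w where "w \<in> A" "w \<notin> set [a, b, x]"
    by (rule obtain_fresh[of "[a, b, x]" A]) (use A4 in auto)
  then have "has_F12 d V"
    using assms(3-) \<open>x \<noteq> b\<close> assms(1)[of b a] by (intro has_F12I[of v b a x w V d i]) auto
  then show False using assms(2) by simp
qed

text \<open>On five \<open>i\<close>-neighbours \<open>R\<close> of \<open>v\<close> colour
  \<open>i\<close> is a matching, which misses some \<open>u\<close> by parity. All edges from
  \<open>u\<close> into \<open>R\<close> have colour \<open>j\<close>, and a path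
  \<open>x y z\<close> of colour \<open>j\<close> in the rest of \<open>R\<close> yields
  \<open>F12\<close> with hub \<open>u\<close>.\<close>

lemma F12_free_two_colours:
  assumes sym: "\<And>x y. d x y = d y x" and F: "\<not> has_F12 d V" and A: "A \<subseteq> V"
    and two: "\<forall>x\<in>A. \<forall>y\<in>A. x \<noteq> y \<longrightarrow> d x y = i0 \<or> d x y = j0"
  shows "card A \<le> 9"
proof (rule ccontr)
  assume "\<not> card A \<le> 9"
  then have A10: "card A \<ge> 10" by simp
  then have "A \<noteq> {}" and finA: "finite A" using card.infinite by fastforce+
  then obtain v where v: "v \<in> A" by blast
  obtain R i j where R: "R \<subseteq> A - {v}" "card R = 5" "\<forall>x\<in>R. d v x = i"
      and ij: "\<forall>x\<in>A. \<forall>y\<in>A. x \<noteq> y \<longrightarrow> d x y = i \<or> d x y = j"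
    by (rule two_coloured_neighbourhood[OF A finA A10 v two])
  have v': "v \<in> V" "R \<subseteq> V" "v \<notin> R" "card R \<ge> 4" using R A v by auto
  have finR: "finite R" using R(2) card.infinite by fastforce
  have matching: "y = z" if "x \<in> R" "y \<in> R" "z \<in> R" "x \<noteq> y" "x \<noteq> z" "d x y = i" "d x z = i" for x y z
    using F12_free_neighbourhood[OF sym F v' R(3), of x z y] that by blast
  have "\<exists>u\<in>R. \<forall>x\<in>R. x \<noteq> u \<longrightarrow> d u x \<noteq> i"
  proof (rule ccontr)
    assume "\<not> ?thesis"
    then have "\<forall>u\<in>R. \<exists>x\<in>R. x \<noteq> u \<and> d u x = i" by blast
    \<comment> \<open>\<open>m\<close> would be an involution without fixed points on
      \<open>R\<close>; three of its pairs need six vertices, but \<open>R\<close> has five.\<close>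
    then obtain m where m: "\<And>u. u \<in> R \<Longrightarrow> m u \<in> R \<and> m u \<noteq> u \<and> d u (m u) = i"
      by metis
    have mm: "m (m u) = u" if "u \<in> R" for u
      using matching[of "m u" "m (m u)" u] m[OF that] m[of "m u"] sym[of u "m u"] that by metis
    obtain e where e: "e \<in> R" using R(2) by fastforce
    obtain f where f: "f \<in> R" "f \<notin> set [e, m e]"
      by (rule obtain_fresh[of "[e, m e]" R]) (use R(2) in auto)
    obtain g where g: "g \<in> R" "g \<notin> set [e, m e, f, m f]"
      by (rule obtain_fresh[of "[e, m e, f, m f]" R]) (use R(2) in auto)
    have "distinct [e, m e, f, m f, g, m g]"
      using m[OF e] m[OF f(1)] m[OF g(1)] f(2) g(2)
        mm[OF e] mm[OF f(1)] mm[OF g(1)] by auto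
    then have "card {e, m e, f, m f, g, m g} = 6" by simp
    moreover have "{e, m e, f, m f, g, m g} \<subseteq> R"
      using m e f(1) g(1) by blast
    ultimately have "6 \<le> card R" using card_mono[OF finR] by metis
    then show False using R(2) by simp
  qed
  then obtain u where u: "u \<in> R" "\<forall>x\<in>R. x \<noteq> u \<longrightarrow> d u x \<noteq> i"
    by blast
  have two_R: "d x y = i \<or> d x y = j" if "x \<in> R" "y \<in> R" "x \<noteq> y" for x y
  proof -
    have "x \<in> A" "y \<in> A" using that R(1) by auto
    then show ?thesis using ij that(3) by blast
  qed
  have uj: "d u x = j" if "x \<in> R" "x \<noteq> u" for x
    using two_R[of u x] u that by blast
  have "card (R - {u}) = 4" using u(1) R(2) by simp
  then have "R - {u} \<noteq> {}" by force
  then obtain y where y: "y \<in> R" "y \<noteq> u" by blast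
  define N where "N = {x\<in>R - {u, y}. d y x = j}"
  \<comment> \<open>Three vertices remain besides \<open>u\<close> and \<open>y\<close>, and at most
    one of them is matched to \<open>y\<close> in colour \<open>i\<close>.\<close>
  have "card N \<ge> 2"
  proof -
    define M where "M = {x\<in>R - {u, y}. d y x = i}"
    have "d y x = i \<or> d y x = j" if "x \<in> R - {u, y}" for x
      using two_R[of y x] y(1) that by blast
    then have "R - {u, y} \<subseteq> N \<union> M"
      by (auto simp: N_def M_def)
    then have "card (R - {u, y}) \<le> card N + card M"
      using finR card_mono[of "N \<union> M" "R - {u, y}"] card_Un_le[of N M]
      by (simp add: N_def M_def)
    moreover have "card (R - {u, y}) = 3"
      using u(1) y R(2) finR by (simp add: card_Diff_subset)
    moreover have "card M \<le> Suc 0"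
    proof -
      have "finite M" using finR by (simp add: M_def)
      moreover have "x = z" if "x \<in> M" "z \<in> M" for x z
        using that matching[of y x z] y(1) by (auto simp: M_def)
      ultimately show ?thesis by (simp add: card_le_Suc0_iff_eq)
    qed
    ultimately show ?thesis by simp
  qed
  then obtain ns where "length ns = 2" "distinct ns" "set ns \<subseteq> N"
    by (rule obtain_distinct_list)
  then obtain x z where xz: "x \<noteq> z" "x \<in> N" "z \<in> N"
    by (auto simp: length_Suc_conv numeral_2_eq_2)
  obtain w where w: "w \<in> R" "w \<notin> set [u, x, y, z]"
    by (rule obtain_fresh[of "[u, x, y, z]" R]) (use R(2) in auto)
  have xz': "x \<in> R" "x \<noteq> u" "x \<noteq> y" "d y x = j" "z \<in> R" "z \<noteq> u" "z \<noteq> y" "d y z = j"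
    using xz(2,3) by (auto simp: N_def)
  have "{u, x, y, z, w} \<subseteq> V" "distinct [u, x, y, z, w]"
    using xz(1) xz' w y u(1) v'(2) by auto
  then have "has_F12 d V"
    using uj xz' y w sym[of x y] by (intro has_F12I[of u x y z w V d j]) auto
  then show False using F by simp
qed

lemma sparse_colouring_F12:
  assumes "finite V" and sym: "\<And>x y. d x y = d y x" and "rainbow_triangle_free d V"
    and F: "\<not> has_F12 d V"
  shows "sparse_colouring d V"
proof
  show "finite V" "rainbow_triangle_free d V" by fact+
  show "d x y = d y x" for x y by (rule sym)
  show "(\<forall>x\<in>A. x \<noteq> a \<longrightarrow> d a x = i \<longrightarrow> x = b) \<or> (\<forall>x\<in>A. x \<noteq> b \<longrightarrow> d b x = i \<longrightarrow> x = a)"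
    if "v \<in> V" "A \<subseteq> V" "v \<notin> A" "card A \<ge> 4" "\<forall>a\<in>A. d v a = i"
      "a \<in> A" "b \<in> A" "a \<noteq> b" "d a b = i" for v A i a b
    using F12_free_neighbourhood[OF sym F that] by blast
  show "d a a' \<noteq> i"
    if "A \<subseteq> V" "C \<subseteq> V" "A \<inter> C = {}" and C3: "card A \<ge> 3" "card C \<ge> 3"
      and ac: "\<forall>a\<in>A. \<forall>c\<in>C. d a c = i" "a \<in> A" "a' \<in> A" "a \<noteq> a'" for A C i a a'
  proof
    assume "d a a' = i"
    obtain cs where "length cs = 3" "distinct cs" "set cs \<subseteq> C"
      by (rule obtain_distinct_list[OF C3(2)])
    then obtain p q s where "distinct [p, q, s]" "{p, q, s} \<subseteq> C"
      by (auto simp: length_Suc_conv numeral_3_eq_3)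
    \<comment> \<open>\<open>a a'\<close> is the middle edge, \<open>p\<close> and \<open>q\<close>
      are the common neighbours of its ends, and \<open>s\<close> hangs at \<open>a\<close>; this
      takes three vertices of \<open>C\<close>.\<close>
    then have "has_F12 d V"
      using that \<open>d a a' = i\<close> sym[of p a'] by (intro has_F12I[of a p a' q s V d i]) auto
    then show False using F by simp
  qed
  show "card A \<le> 9" if "A \<subseteq> V" "\<forall>x\<in>A. \<forall>y\<in>A. x \<noteq> y \<longrightarrow> d x y = i \<or> d x y = j" for A i j
    by (rule F12_free_two_colours[OF sym F that])
qed

text \<open>Any vertex of a \<open>K4\<close> becomes an end of degree 2 when an edge at it is
  deleted, so an edge of the same colour leaving the \<open>K4\<close> anywhere completes
  \<open>F13\<close>.\<close>

lemma has_F13_of_K4: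
  assumes "distinct [p, q, s, t, f]" "{p, q, s, t, f} \<subseteq> V" and sym: "\<And>x y. d x y = d y x"
    and "d p q = j" "d p s = j" "d p t = j" "d q s = j" "d q t = j" "d s t = j"
    and "d f p = j \<or> d f q = j \<or> d f s = j \<or> d f t = j"
  shows "has_F13 d V"
proof -
  have sym': "d q p = j" "d s p = j" "d t p = j" "d s q = j" "d t q = j" "d t s = j"
    using assms(4-9) sym by metis+
  from assms(10) consider "d p f = j" | "d q f = j" | "d s f = j" | "d t f = j"
    using sym by metis
  then show ?thesis
  proof cases
    case 1
    then show ?thesis using assms sym' by (intro has_F13I[of p q s t f V d j]) auto
  next
    case 2
    then show ?thesis using assms sym' by (intro has_F13I[of q p s t f V d j]) auto
  next
    case 3
    then show ?thesis using assms sym' by (intro has_F13I[of s p q t f V d j]) auto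
  next
    case 4
    then show ?thesis using assms sym' by (intro has_F13I[of t p q s f V d j]) auto
  qed
qed

text \<open>Let \<open>x\<close> and \<open>y\<close> be further \<open>i\<close>-neighbours of
  \<open>a\<close> and \<open>b\<close>. If \<open>x = y\<close>, then \<open>v\<close>,
  \<open>a\<close>, \<open>b\<close>, \<open>x\<close> span a \<open>K4\<close> and a fourth vertex
  of \<open>A\<close> hangs at \<open>v\<close>; otherwise the triangles \<open>v a b\<close> and
  \<open>v a x\<close> share the edge \<open>v a\<close>, and \<open>y\<close> hangs at
  \<open>b\<close>.\<close>

lemma F13_free_neighbourhood:
  assumes sym: "\<And>x y. d x y = d y x" and F: "\<not> has_F13 d V"
    and v: "v \<in> V" "A \<subseteq> V" "v \<notin> A" and A4: "card A \<ge> 4" and va: "\<forall>a\<in>A. d v a = i"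
    and ab: "a \<in> A" "b \<in> A" "a \<noteq> b" "d a b = i"
  shows "(\<forall>x\<in>A. x \<noteq> a \<longrightarrow> d a x = i \<longrightarrow> x = b) \<or> (\<forall>x\<in>A. x \<noteq> b \<longrightarrow> d b x = i \<longrightarrow> x = a)"
proof (rule ccontr)
  assume "\<not> ?thesis"
  then obtain x y where x: "x \<in> A" "x \<noteq> a" "d a x = i" "x \<noteq> b"
      and y: "y \<in> A" "y \<noteq> b" "d b y = i" "y \<noteq> a" by blast
  have "has_F13 d V"
  proof (cases "x = y")
    case True
    obtain w where "w \<in> A" "w \<notin> set [a, b, x]"
      by (rule obtain_fresh[of "[a, b, x]" A]) (use A4 in auto)
    then show ?thesis
      using v va ab x y True sym[of x a] sym[of x b]
      by (intro has_F13I[of v x a b w V d i]) auto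
  next
    case False
    then show ?thesis
      using v va ab x y sym[of b v] sym[of b a] sym[of x a] sym[of x v]
      by (intro has_F13I[of b x v a y V d i]) auto
  qed
  then show False using F by simp
qed

text \<open>On five \<open>i\<close>-neighbours \<open>R\<close> of \<open>v\<close> colour
  \<open>i\<close> is a star forest without a spanning star. An independent half contains a triangle
  \<open>p q r\<close> of colour \<open>j\<close>; each of the other two vertices sends two
  \<open>i\<close>-edges to it, so they share an \<open>i\<close>-neighbour, against the star
  condition.\<close>

lemma F13_free_two_colours:
  assumes sym: "\<And>x y. d x y = d y x" and F: "\<not> has_F13 d V" and A: "A \<subseteq> V"
    and two: "\<forall>x\<in>A. \<forall>y\<in>A. x \<noteq> y \<longrightarrow> d x y = i0 \<or> d x y = j0"
  shows "card A \<le> 9"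
proof (rule ccontr)
  assume "\<not> card A \<le> 9"
  then have A10: "card A \<ge> 10" by simp
  then have "A \<noteq> {}" and finA: "finite A" using card.infinite by fastforce+
  then obtain v where v: "v \<in> A" by blast
  obtain R i j where R: "R \<subseteq> A - {v}" "card R = 5" "\<forall>x\<in>R. d v x = i"
      and ij: "\<forall>x\<in>A. \<forall>y\<in>A. x \<noteq> y \<longrightarrow> d x y = i \<or> d x y = j"
    by (rule two_coloured_neighbourhood[OF A finA A10 v two])
  have v': "v \<in> V" "R \<subseteq> V" "v \<notin> R" "card R \<ge> 4" using R A v by auto
  have finR: "finite R" using R(2) card.infinite by fastforce
  have RA: "R \<subseteq> A" using R(1) by blast
  have leaf: "(\<forall>z\<in>R. z \<noteq> x \<longrightarrow> d x z = i \<longrightarrow> z = y) \<or> (\<forall>z\<in>R. z \<noteq> y \<longrightarrow> d y z = i \<longrightarrow> z = x)"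
    if "x \<in> R" "y \<in> R" "x \<noteq> y" "d x y = i" for x y
    by (rule F13_free_neighbourhood[OF sym F v' R(3) that])
  have not_i: "d x y = j" if "x \<in> R" "y \<in> R" "x \<noteq> y" "d x y \<noteq> i" for x y
    using ij RA that by blast
  \<comment> \<open>A centre \<open>x\<close> would leave a \<open>K4\<close> of colour
    \<open>j\<close> in \<open>R\<close>. Every other vertex of \<open>A\<close> is then joined to
    \<open>p\<close> and \<open>q\<close> in \<open>i\<close>, among them \<open>v\<close>,
    \<open>x\<close> and one more \<open>w\<close>: this gives \<open>F13\<close> around the edge
    \<open>v x\<close>.\<close>
  have no_centre: "\<exists>y\<in>R. y \<noteq> x \<and> d x y \<noteq> i" if x: "x \<in> R" for x
  proof (rule ccontr)
    assume "\<not> ?thesis"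
    then have xi: "\<And>y. y \<in> R \<Longrightarrow> y \<noteq> x \<Longrightarrow> d x y = i" by blast
    have "4 \<le> card (R - {x})" using x R(2) by simp
    then obtain ps where "length ps = 4" "distinct ps" "set ps \<subseteq> R - {x}"
      by (rule obtain_distinct_list)
    then obtain p q s t where ps: "distinct [p, q, s, t]" "{p, q, s, t} \<subseteq> R - {x}"
      by (auto simp: length_Suc_conv numeral_eq_Suc)
    have pj: "d y z = j" if yz: "y \<in> R - {x}" "z \<in> R - {x}" "y \<noteq> z" for y z
    proof (rule not_i)
      show "y \<in> R" "z \<in> R" "y \<noteq> z" using yz by auto
      show "d y z \<noteq> i"
      proof
        assume "d y z = i"
        moreover have "\<exists>w\<in>R. w \<notin> set [x, y, z]"
          by (rule obtain_fresh[of "[x, y, z]" R]) (use R(2) in auto)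
        then obtain w where "w \<in> R" "w \<noteq> x" "w \<noteq> y" "w \<noteq> z" by auto
        ultimately show False
          using leaf[of x y] xi[of y] xi[of z] xi[of w] yz leaf[of y x] sym[of y x] x by auto
      qed
    qed
    have outside: "d p w = i \<and> d q w = i" if w: "w \<in> A" "w \<notin> {p, q, s, t}" for w
    proof (rule ccontr)
      assume "\<not> ?thesis"
      moreover have "p \<in> A" "q \<in> A" "p \<noteq> w" "q \<noteq> w" using ps w RA by auto
      ultimately have "d p w = j \<or> d q w = j" using ij w by blast
      then have "d w p = j \<or> d w q = j \<or> d w s = j \<or> d w t = j"
        using sym[of w p] sym[of w q] by metis
      then have "has_F13 d V"
        using ps w A RA pj[of p q] pj[of p s] pj[of p t] pj[of q s] pj[of q t] pj[of s t]
        by (intro has_F13_of_K4[of p q s t w V d j] sym) auto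
      then show False using F by simp
    qed
    obtain w where w: "w \<in> A" "w \<notin> set [p, q, s, t, v, x]"
      by (rule obtain_fresh[of "[p, q, s, t, v, x]" A]) (use A10 in auto)
    have "has_F13 d V"
    proof (rule has_F13I[of p q v x w V d i])
      show "{p, q, v, x, w} \<subseteq> V" using ps(2) w A RA v x by auto
      show "distinct [p, q, v, x, w]" using ps w v'(3) x by auto
      show "d v x = i" using R(3) x by blast
      show "d p v = i" "d q v = i" using outside[OF v] v'(3) ps(2) by auto
      show "d p x = i" "d q x = i" using outside[of x] x RA ps(2) by auto
      show "d p w = i" using outside[OF w(1)] w(2) by auto
    qed
    then show False using F by simp
  qed
  have "\<exists>I\<subseteq>R. card R \<le> 2 * card I \<and> (\<forall>x\<in>I. \<forall>y\<in>I. x \<noteq> y \<longrightarrow> d x y \<noteq> i)"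
  proof (rule independent_half[OF finR])
    show "d y x = i" if "d x y = i" for x y using that sym[of x y] by simp
  qed (rule leaf)
  then obtain I where I: "I \<subseteq> R" "card R \<le> 2 * card I"
      "\<forall>x\<in>I. \<forall>y\<in>I. x \<noteq> y \<longrightarrow> d x y \<noteq> i" by blast
  have "3 \<le> card I" using I(2) R(2) by simp
  then obtain ps where "length ps = 3" "distinct ps" "set ps \<subseteq> I"
    by (rule obtain_distinct_list)
  then obtain p q r where pqr: "distinct [p, q, r]" "{p, q, r} \<subseteq> I"
    by (auto simp: length_Suc_conv numeral_eq_Suc)
  then have pqrR: "p \<in> R" "q \<in> R" "r \<in> R" using I(1) by auto
  have tri: "d p q = j" "d p r = j" "d q r = j"
    using pqr I(3) pqrR by (auto intro!: not_i)
  obtain s where s: "s \<in> R" "s \<notin> set [p, q, r]"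
    by (rule obtain_fresh[of "[p, q, r]" R]) (use R(2) in auto)
  obtain t where t: "t \<in> R" "t \<notin> set [p, q, r, s]"
    by (rule obtain_fresh[of "[p, q, r, s]" R]) (use R(2) in auto)
  have dist: "distinct [p, q, r, s, t]" using pqr(1) s(2) t(2) by auto
  then have "card {p, q, r, s, t} = card R" using R(2) by simp
  then have Req: "R = {p, q, r, s, t}"
    using pqrR s(1) t(1) by (intro card_subset_eq[OF finR, symmetric]) auto
  \<comment> \<open>The triangles \<open>a b c\<close> and \<open>a b y\<close> share
    \<open>a b\<close>, so a \<open>j\<close>-edge from \<open>z\<close> to \<open>c\<close> or
    \<open>y\<close> gives \<open>F13\<close>. Otherwise \<open>z\<close> is the centre of an
    \<open>i\<close>-star with leaves \<open>c\<close> and \<open>y\<close>, so \<open>y c\<close>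
    has colour \<open>j\<close>; then \<open>a b c y\<close> is a \<open>K4\<close> and
    \<open>no_centre\<close> supplies a \<open>j\<close>-edge from \<open>z\<close> to it.\<close>
  have at_most_one: False
    if abc: "distinct [a, b, c, y, z]" "R = {a, b, c, y, z}" "d a b = j" "d a c = j" "d b c = j"
      and yab: "d y a = j" "d y b = j" for a b c y z
  proof -
    have RV: "{a, b, c, y, z} \<subseteq> V" using abc(2) v'(2) by simp
    have mem: "a \<in> R" "b \<in> R" "c \<in> R" "y \<in> R" "z \<in> R" using abc(2) by auto
    have ne: "c \<noteq> z" "y \<noteq> z" "y \<noteq> c" using abc(1) by auto
    have "has_F13 d V"
    proof (cases "d c z = j \<or> d y z = j")
      case True
      then show ?thesis
      proof
        assume "d c z = j"
        then show ?thesis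
          using RV abc yab sym[of c a] sym[of c b] by (intro has_F13I[of c y a b z V d j]) auto
      next
        assume "d y z = j"
        then show ?thesis
          using RV abc yab sym[of c a] sym[of c b] by (intro has_F13I[of y c a b z V d j]) auto
      qed
    next
      case False
      then have "d c z = i" "d y z = i" using not_i mem ne by blast+
      then have "d y c \<noteq> i"
        using leaf[of y z] mem ne sym[of z c] by auto
      then have yc: "d y c = j" using not_i mem ne by blast
      obtain w where "w \<in> R" "w \<noteq> z" "d z w \<noteq> i" using no_centre[OF mem(5)] by blast
      then have "d z w = j" "w \<in> {a, b, c, y}" using not_i[of z w] mem(5) abc(2) by auto
      then have "d z a = j \<or> d z b = j \<or> d z c = j \<or> d z y = j" by auto
      then show ?thesis
        using RV abc yab yc sym[of y a] sym[of y b] sym[of y c]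
        by (intro has_F13_of_K4[of a b c y z V d j] sym) auto
    qed
    then show False using F by simp
  qed
  have two_i: "d y p = i \<and> d y q = i \<or> d y p = i \<and> d y r = i \<or> d y q = i \<and> d y r = i"
    if y: "distinct [p, q, r, y, z]" "R = {p, q, r, y, z}" for y z
  proof -
    have "\<not> (d y p = j \<and> d y q = j)"
      using at_most_one[of p q r y z] y tri by blast
    moreover have "\<not> (d y p = j \<and> d y r = j)"
      using at_most_one[of p r q y z] y tri sym[of r q] by fastforce
    moreover have "\<not> (d y q = j \<and> d y r = j)"
      using at_most_one[of q r p y z] y tri sym[of q p] sym[of r p] by fastforce
    moreover have "d y x = i \<or> d y x = j" if "x \<in> {p, q, r}" for x
      using not_i[of y x] y that by auto
    ultimately show ?thesis by blast
  qed
  \<comment> \<open>The edge \<open>s x\<close> would have a further \<open>i\<close>-edge at both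
    ends, namely \<open>s w\<close> and \<open>t x\<close>.\<close>
  have no_common: False
    if "x \<in> {p, q, r}" "w \<in> {p, q, r}" "x \<noteq> w" "d s x = i" "d s w = i" "d t x = i" for x w
  proof -
    have "x \<in> R" "w \<in> R" "s \<noteq> x" "s \<noteq> w" "t \<noteq> x" "t \<noteq> s"
      using that(1,2) dist Req by auto
    then show False
      using leaf[of s x] that(3-6) s(1) t(1) sym[of x t] by metis
  qed
  have "p \<noteq> q" "p \<noteq> r" "q \<noteq> r" using dist by auto
  moreover have "R = {p, q, r, t, s}" "distinct [p, q, r, t, s]" using Req dist by auto
  \<comment> \<open>Two pairs taken from \<open>{p, q, r}\<close> intersect, so \<open>s\<close> and
    \<open>t\<close> do have a common \<open>i\<close>-neighbour.\<close>
  ultimately show False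
    using two_i[OF dist Req] two_i[of t s]
      no_common[of p q] no_common[of p r] no_common[of q p] no_common[of q r]
      no_common[of r p] no_common[of r q] by auto
qed

lemma sparse_colouring_F13:
  assumes "finite V" and sym: "\<And>x y. d x y = d y x" and "rainbow_triangle_free d V"
    and F: "\<not> has_F13 d V"
  shows "sparse_colouring d V"
proof
  show "finite V" "rainbow_triangle_free d V" by fact+
  show "d x y = d y x" for x y by (rule sym)
  show "(\<forall>x\<in>A. x \<noteq> a \<longrightarrow> d a x = i \<longrightarrow> x = b) \<or> (\<forall>x\<in>A. x \<noteq> b \<longrightarrow> d b x = i \<longrightarrow> x = a)"
    if "v \<in> V" "A \<subseteq> V" "v \<notin> A" "card A \<ge> 4" "\<forall>a\<in>A. d v a = i"
      "a \<in> A" "b \<in> A" "a \<noteq> b" "d a b = i" for v A i a b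
    by (rule F13_free_neighbourhood[OF sym F that])
  show "d a a' \<noteq> i"
    if AC: "A \<subseteq> V" "C \<subseteq> V" "A \<inter> C = {}" and C3: "card A \<ge> 3" "card C \<ge> 3"
      and ac: "\<forall>a\<in>A. \<forall>c\<in>C. d a c = i" "a \<in> A" "a' \<in> A" "a \<noteq> a'" for A C i a a'
  proof
    assume "d a a' = i"
    obtain cs where "length cs = 3" "distinct cs" "set cs \<subseteq> C"
      by (rule obtain_distinct_list[OF C3(2)])
    then obtain p q where pq: "p \<noteq> q" "{p, q} \<subseteq> C"
      by (auto simp: length_Suc_conv numeral_3_eq_3)
    obtain w where w: "w \<in> A" "w \<notin> set [a, a']"
      by (rule obtain_fresh[of "[a, a']" A]) (use C3 in auto)
    have "{p, q, a, a', w} \<subseteq> V" "distinct [p, q, a, a', w]"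
      using AC ac pq w by auto
    \<comment> \<open>Around the middle edge \<open>a a'\<close> the ends are \<open>p\<close> and
      \<open>q\<close>; the pendant vertex \<open>w\<close> at \<open>p\<close> now comes from
      \<open>A\<close>.\<close>
    then have "has_F13 d V"
      using ac pq w \<open>d a a' = i\<close> sym[of p] sym[of q]
      by (intro has_F13I[of p q a a' w V d i]) auto
    then show False using F by simp
  qed
  show "card A \<le> 9" if "A \<subseteq> V" "\<forall>x\<in>A. \<forall>y\<in>A. x \<noteq> y \<longrightarrow> d x y = i \<or> d x y = j" for A i j
    by (rule F13_free_two_colours[OF sym F that])
qed

section \<open>Copies in complete graphs\<close>

text \<open>A copy is determined by the injective map that realises it. The arbitrary
  \<open>P\<close> covers rainbow and monochromatic copies alike.\<close>

lemma ex_copy_in_complete_graph: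
  assumes "simple_graph H"
  shows "(\<exists>H'. is_copy_in H' H (complete_graph N) \<and> P H') \<longleftrightarrow>
    (\<exists>f. inj_on f (verts H) \<and> f ` verts H \<subseteq> {..<N} \<and> P (f ` verts H, (`) f ` edges H))"
    (is "?L \<longleftrightarrow> ?R")
proof
  assume ?L
  then obtain H' f where H': "subgraph H' (complete_graph N)" "P H'"
      and f: "bij_betw f (verts H) (verts H')" "edges H' = (`) f ` edges H"
    by (auto simp: is_copy_in_def isomorphic_def)
  have "H' = (f ` verts H, (`) f ` edges H)"
    using f by (simp add: bij_betw_def verts_def edges_def prod_eq_iff)
  moreover have "f ` verts H \<subseteq> {..<N}" "inj_on f (verts H)"
    using H'(1) f(1) by (auto simp: subgraph_def complete_graph_def verts_def bij_betw_def)
  ultimately show ?R using H'(2) by blast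
next
  assume ?R
  then obtain f where f: "inj_on f (verts H)" "f ` verts H \<subseteq> {..<N}"
      and P: "P (f ` verts H, (`) f ` edges H)" by blast
  let ?H = "(f ` verts H, (`) f ` edges H)"
  have e: "e \<subseteq> verts H \<and> card e = 2" if "e \<in> edges H" for e
    using assms that by (simp add: simple_graph_def)
  have "f ` e \<subseteq> f ` verts H \<and> card (f ` e) = 2" if "e \<in> edges H" for e
  proof
    show "f ` e \<subseteq> f ` verts H" using e[OF that] by blast
    have "inj_on f e" using f(1) e[OF that] inj_on_subset by blast
    then show "card (f ` e) = 2" using e[OF that] by (simp add: card_image)
  qed
  then have "subgraph ?H (complete_graph N)"
    using f(2) by (auto simp: subgraph_def simple_graph_def verts_def edges_def complete_graph_def)
  moreover have "isomorphic H ?H"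
    unfolding isomorphic_def using f(1) by (auto simp: bij_betw_def verts_def edges_def)
  ultimately show ?L using P unfolding is_copy_in_def by blast
qed

lemma monochromaticD:
  "monochromatic c G \<Longrightarrow> e \<in> edges G \<Longrightarrow> e' \<in> edges G \<Longrightarrow> c e = c e'"
  unfolding monochromatic_def by metis

text \<open>Passes from copies as subgraphs to the pattern of a two-argument colouring, the form in
  which the combinatorial part works.\<close>

lemma mono_copy_F12_iff:
  "(\<exists>H'. is_copy_in H' F12 (complete_graph N) \<and> monochromatic c H') \<longleftrightarrow>
    has_F12 (\<lambda>x y. c {x, y}) {..<N}"
    (is "?L \<longleftrightarrow> ?R")
proof
  assume ?L
  then obtain f where f: "inj_on f (verts F12)" "f ` verts F12 \<subseteq> {..<N}"
      "monochromatic c (f ` verts F12, (`) f ` edges F12)"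
    unfolding ex_copy_in_complete_graph[OF simple_graph_F12] by blast
  then have sub: "{f 0, f 1, f 2, f 3, f 4} \<subseteq> {..<N}" and dist: "distinct [f 0, f 1, f 2, f 3, f 4]"
    by (auto simp: F12_def verts_def inj_on_def)
  have E: "edges (f ` verts F12, (`) f ` edges F12) =
      {{f 0, f 1}, {f 0, f 2}, {f 0, f 3}, {f 1, f 2}, {f 2, f 3}, {f 0, f 4}}"
    by (simp add: F12_def edges_def)
  have eq: "c e = c {f 0, f 1}" if "e \<in> {{f 0, f 1}, {f 0, f 2}, {f 0, f 3}, {f 1, f 2}, {f 2, f 3}, {f 0, f 4}}" for e
  proof (rule monochromaticD[OF f(3)])
    show "e \<in> edges (f ` verts F12, (`) f ` edges F12)" unfolding E by (rule that)
    show "{f 0, f 1} \<in> edges (f ` verts F12, (`) f ` edges F12)" unfolding E by simp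
  qed
  show ?R
    by (rule has_F12I[where d = "\<lambda>x y. c {x, y}" and i = "c {f 0, f 1}",
          OF sub dist refl eq eq eq eq eq]) simp_all
next
  assume ?R
  then obtain u x y z w i where F: "{u, x, y, z, w} \<subseteq> {..<N}" "distinct [u, x, y, z, w]"
      "c {u, x} = i" "c {u, y} = i" "c {u, z} = i" "c {x, y} = i" "c {y, z} = i" "c {u, w} = i"
    by (rule has_F12E)
  \<comment> \<open>The default value of \<open>f\<close> serves vertex 4; \<open>Suc 0\<close> is
    the simp normal form of 1.\<close>
  define f :: "nat \<Rightarrow> nat" where "f = (\<lambda>_. w)(0 := u, Suc 0 := x, 2 := y, 3 := z)"
  have f: "f 0 = u" "f (Suc 0) = x" "f 2 = y" "f 3 = z" "f 4 = w" by (simp_all add: f_def)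
  have "inj_on f (verts F12)"
    using F(2) by (auto simp: F12_def verts_def f)
  moreover have "f ` verts F12 \<subseteq> {..<N}"
    using F(1) by (auto simp: F12_def verts_def f)
  moreover have "monochromatic c (f ` verts F12, (`) f ` edges F12)"
    using F(3-) by (simp add: F12_def edges_def monochromatic_def f)
  ultimately show ?L
    unfolding ex_copy_in_complete_graph[OF simple_graph_F12] by blast
qed

lemma mono_copy_F13_iff:
  "(\<exists>H'. is_copy_in H' F13 (complete_graph N) \<and> monochromatic c H') \<longleftrightarrow>
    has_F13 (\<lambda>x y. c {x, y}) {..<N}"
    (is "?L \<longleftrightarrow> ?R")
proof
  assume ?L
  then obtain f where f: "inj_on f (verts F13)" "f ` verts F13 \<subseteq> {..<N}"
      "monochromatic c (f ` verts F13, (`) f ` edges F13)"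
    unfolding ex_copy_in_complete_graph[OF simple_graph_F13] by blast
  then have sub: "{f 0, f 1, f 2, f 3, f 4} \<subseteq> {..<N}" and dist: "distinct [f 0, f 1, f 2, f 3, f 4]"
    by (auto simp: F13_def verts_def inj_on_def)
  have E: "edges (f ` verts F13, (`) f ` edges F13) =
      {{f 0, f 2}, {f 0, f 3}, {f 1, f 2}, {f 1, f 3}, {f 2, f 3}, {f 0, f 4}}"
    by (simp add: F13_def edges_def)
  have eq: "c e = c {f 0, f 2}" if "e \<in> {{f 0, f 2}, {f 0, f 3}, {f 1, f 2}, {f 1, f 3}, {f 2, f 3}, {f 0, f 4}}" for e
  proof (rule monochromaticD[OF f(3)])
    show "e \<in> edges (f ` verts F13, (`) f ` edges F13)" unfolding E by (rule that)
    show "{f 0, f 2} \<in> edges (f ` verts F13, (`) f ` edges F13)" unfolding E by simp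
  qed
  show ?R
    by (rule has_F13I[where d = "\<lambda>x y. c {x, y}" and i = "c {f 0, f 2}",
          OF sub dist refl eq eq eq eq eq]) simp_all
next
  assume ?R
  then obtain u v x y z i where F: "{u, v, x, y, z} \<subseteq> {..<N}" "distinct [u, v, x, y, z]"
      "c {u, x} = i" "c {u, y} = i" "c {v, x} = i" "c {v, y} = i" "c {x, y} = i" "c {u, z} = i"
    by (rule has_F13E)
  define f :: "nat \<Rightarrow> nat" where "f = (\<lambda>_. z)(0 := u, Suc 0 := v, 2 := x, 3 := y)"
  have f: "f 0 = u" "f (Suc 0) = v" "f 2 = x" "f 3 = y" "f 4 = z" by (simp_all add: f_def)
  have "inj_on f (verts F13)"
    using F(2) by (auto simp: F13_def verts_def f)
  moreover have "f ` verts F13 \<subseteq> {..<N}"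
    using F(1) by (auto simp: F13_def verts_def f)
  moreover have "monochromatic c (f ` verts F13, (`) f ` edges F13)"
    using F(3-) by (simp add: F13_def edges_def monochromatic_def f)
  ultimately show ?L
    unfolding ex_copy_in_complete_graph[OF simple_graph_F13] by blast
qed

lemma verts_complete_graph_3: "verts (complete_graph 3) = {0, 1, 2}"
  unfolding complete_graph_def verts_def by auto

lemma edges_complete_graph_3: "edges (complete_graph 3) = {{0, 1}, {0, 2}, {1, 2}}"
proof -
  have "{..<3} = {0, 1, 2::nat}" by auto
  then have "edges (complete_graph 3) = {e. e \<subseteq> {0, 1, 2} \<and> card e = 2}"
    by (simp add: complete_graph_def edges_def)
  also have "\<dots> = {{0, 1}, {0, 2}, {1, 2}}"
  proof
    show "{e. e \<subseteq> {0, 1, 2} \<and> card e = 2} \<subseteq> {{0, 1}, {0, 2}, {1, 2::nat}}"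
      by (auto simp: card_2_iff)
  qed auto
  finally show ?thesis .
qed

lemma rainbow_copy_triangle_iff:
  "(\<exists>G'. is_copy_in G' (complete_graph 3) (complete_graph N) \<and> rainbow c G') \<longleftrightarrow>
    \<not> rainbow_triangle_free (\<lambda>x y. c {x, y}) {..<N}"
    (is "?L \<longleftrightarrow> ?R")
proof
  assume ?L
  then obtain f where f: "inj_on f {0, 1, 2::nat}" "f ` {0, 1, 2} \<subseteq> {..<N}"
      and r: "inj_on c {{f 0, f 1}, {f 0, f 2}, {f 1, f 2}}"
    unfolding ex_copy_in_complete_graph[OF simple_graph_complete_graph] rainbow_def
      verts_complete_graph_3 edges_complete_graph_3 by (auto simp: edges_def)
  then have ne: "f 0 \<noteq> f 1" "f 0 \<noteq> f 2" "f 1 \<noteq> f 2" by auto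
  then have "c {f 0, f 1} \<noteq> c {f 0, f 2}" "c {f 0, f 1} \<noteq> c {f 1, f 2}"
      "c {f 0, f 2} \<noteq> c {f 1, f 2}"
    using r by (auto simp: inj_on_def doubleton_eq_iff)
  moreover have "f 0 \<in> {..<N}" "f 1 \<in> {..<N}" "f 2 \<in> {..<N}" using f(2) by auto
  ultimately show ?R using ne unfolding rainbow_triangle_free_def by blast
next
  assume ?R
  then obtain x y z where xyz: "x < N" "y < N" "z < N" "x \<noteq> y" "x \<noteq> z" "y \<noteq> z"
      and r: "c {x, y} \<noteq> c {x, z}" "c {x, y} \<noteq> c {y, z}" "c {x, z} \<noteq> c {y, z}"
    unfolding rainbow_triangle_free_def by auto
  define f :: "nat \<Rightarrow> nat" where "f = (\<lambda>_. z)(0 := x, Suc 0 := y)"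
  have f: "f 0 = x" "f (Suc 0) = y" "f 2 = z" by (simp_all add: f_def)
  have "inj_on f (verts (complete_graph 3))" "f ` verts (complete_graph 3) \<subseteq> {..<N}"
    using xyz by (auto simp: verts_complete_graph_3 f)
  moreover have "rainbow c (f ` verts (complete_graph 3), (`) f ` edges (complete_graph 3))"
    using r unfolding rainbow_def edges_complete_graph_3 by (auto simp: f edges_def)
  ultimately show ?L
    unfolding ex_copy_in_complete_graph[OF simple_graph_complete_graph] by blast
qed

section \<open>Lower bound\<close>

text \<open>Avoiding both graphs at once lets one construction serve both Ramsey numbers. Symmetry
  and the colour bound hold on all of \<open>nat\<close>, so index computations carry no side
  conditions for them.\<close>

definition extremal_colouring :: "nat \<Rightarrow> nat \<Rightarrow> (nat \<Rightarrow> nat \<Rightarrow> nat) \<Rightarrow> bool" where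
  "extremal_colouring k n g \<longleftrightarrow> (\<forall>x y. g x y = g y x) \<and> (\<forall>x y. g x y < k) \<and>
     rainbow_triangle_free g {..<n} \<and> \<not> has_F12 g {..<n} \<and> \<not> has_F13 g {..<n}"

lemma extremal_colouring_1: "extremal_colouring (Suc 0) 4 (\<lambda>x y. 0)"
proof -
  have no5: False if "{a, b, c, e, f} \<subseteq> {..<4::nat}" "distinct [a, b, c, e, f]" for a b c e f
    using card_mono[OF _ that(1)] distinct_card[OF that(2)] by simp
  have "\<not> has_F12 (\<lambda>x y. 0) {..<4::nat}" "\<not> has_F13 (\<lambda>x y. 0) {..<4::nat}"
    unfolding has_F12_def has_F13_def using no5 by blast+
  then show ?thesis
    by (simp add: extremal_colouring_def rainbow_triangle_free_def)
qed

section \<open>Two colours: the 3x3 rook graph\<close>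

lemma pigeonhole_3:
  fixes a b c e :: nat
  assumes "a < 3" "b < 3" "c < 3" "e < 3"
  shows "a = b \<or> a = c \<or> a = e \<or> b = c \<or> b = e \<or> c = e"
  using assms by arith

text \<open>Adjacency in the 3x3 rook graph, which is the Paley graph on 9 vertices.\<close>

definition aligned :: "nat \<times> nat \<Rightarrow> nat \<times> nat \<Rightarrow> bool" where
  "aligned p q \<longleftrightarrow> fst p = fst q \<or> snd p = snd q"

text \<open>Two triangles on the edge \<open>x y\<close> form \<open>K4\<close> minus an edge, which
  lies in both \<open>F12\<close> and \<open>F13\<close>. In the rook graph both triangles lie in
  the one line through \<open>x\<close> and \<open>y\<close>, which has only three cells; in the
  complement both coordinates of a common neighbour of \<open>x\<close> and \<open>y\<close> are
  forced.\<close>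

lemma aligned_book_free:
  assumes "{x, y, u, v} \<subseteq> {..<3} \<times> {..<3}" "distinct [x, y, u, v]"
    and "aligned x y = t" "aligned u x = t" "aligned u y = t" "aligned v x = t" "aligned v y = t"
  shows False
proof -
  obtain x1 x2 y1 y2 u1 u2 v1 v2
    where [simp]: "x = (x1, x2)" "y = (y1, y2)" "u = (u1, u2)" "v = (v1, v2)"
    by (metis surj_pair)
  have small: "x1 < 3" "y1 < 3" "u1 < 3" "v1 < 3" "x2 < 3" "y2 < 3" "u2 < 3" "v2 < 3"
    using assms(1) by auto
  note rows = pigeonhole_3[OF small(1-4)] and columns = pigeonhole_3[OF small(5-8)]
  show False
  proof (cases t)
    case True
    then have t: "x1 = y1 \<or> x2 = y2" "u1 = x1 \<or> u2 = x2" "u1 = y1 \<or> u2 = y2"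
        "v1 = x1 \<or> v2 = x2" "v1 = y1 \<or> v2 = y2"
      using assms(3-) by (simp_all add: aligned_def)
    have "x1 = y1 \<and> u1 = x1 \<and> v1 = x1 \<or> x2 = y2 \<and> u2 = x2 \<and> v2 = x2"
      using t assms(2) by auto
    then show False using rows columns assms(2) by auto
  next
    case False
    then have "x1 \<noteq> y1" "x2 \<noteq> y2" "u1 \<noteq> x1" "u2 \<noteq> x2" "u1 \<noteq> y1" "u2 \<noteq> y2"
        "v1 \<noteq> x1" "v2 \<noteq> x2" "v1 \<noteq> y1" "v2 \<noteq> y2"
      using assms(3-) by (simp_all add: aligned_def)
    then have "u1 = v1" "u2 = v2" using rows columns by auto
    then show False using assms(2) by simp
  qed
qed

definition rook :: "nat \<Rightarrow> nat \<Rightarrow> nat" where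
  "rook x y = of_bool (aligned (x div 3, x mod 3) (y div 3, y mod 3))"

lemma rook_book_free:
  assumes "x < 9" "y < 9" "u < 9" "v < 9" "distinct [x, y, u, v]"
    and "rook x y = i" "rook u x = i" "rook u y = i" "rook v x = i" "rook v y = i"
  shows False
proof (rule aligned_book_free)
  let ?p = "\<lambda>n :: nat. (n div 3, n mod 3)"
  have "inj ?p"
    by (rule injI) (metis div_mult_mod_eq prod.inject)
  then have "distinct (map ?p [x, y, u, v])"
    using assms(5) unfolding distinct_map by (blast intro: inj_on_subset)
  then show "distinct [?p x, ?p y, ?p u, ?p v]" by (simp only: list.map)
  have "?p n \<in> {..<3} \<times> {..<3}" if "n < 9" for n
  proof -
    have "n div 3 < 3" using that by auto
    then show ?thesis by simp
  qed
  then show "{?p x, ?p y, ?p u, ?p v} \<subseteq> {..<3} \<times> {..<3}"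
    using assms(1-4) by blast
  have colour: "aligned (?p a) (?p b) = (i = 1)" if "rook a b = i" for a b
    unfolding that[symmetric] rook_def by simp
  show "aligned (?p x) (?p y) = (i = 1)" "aligned (?p u) (?p x) = (i = 1)"
      "aligned (?p u) (?p y) = (i = 1)" "aligned (?p v) (?p x) = (i = 1)"
      "aligned (?p v) (?p y) = (i = 1)"
    by (rule colour; fact)+
qed

lemma extremal_colouring_2: "extremal_colouring (Suc (Suc 0)) 9 rook"
proof -
  have sym: "rook x y = rook y x" for x y by (simp add: rook_def aligned_def eq_commute)
  have "rook x y < Suc (Suc 0)" for x y by (simp add: rook_def)
  moreover have "rainbow_triangle_free rook {..<9}"
  proof -
    have "rook x y = 0 \<or> rook x y = 1" for x y by (simp add: rook_def)
    then show ?thesis unfolding rainbow_triangle_free_def by metis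
  qed
  moreover have "\<not> has_F12 rook {..<9}"
  proof
    assume "has_F12 rook {..<9}"
    then obtain u x y z w i where "{u, x, y, z, w} \<subseteq> {..<9}" "distinct [u, x, y, z, w]"
        "rook u x = i" "rook u y = i" "rook u z = i" "rook x y = i" "rook y z = i"
        "rook u w = i"
      by (rule has_F12E)
    then show False
      using sym[of x u] sym[of z u] sym[of z y] by (intro rook_book_free[of u y x z i]) auto
  qed
  moreover have "\<not> has_F13 rook {..<9}"
  proof
    assume "has_F13 rook {..<9}"
    then obtain u v x y z i where "{u, v, x, y, z} \<subseteq> {..<9}" "distinct [u, v, x, y, z]"
        "rook u x = i" "rook u y = i" "rook v x = i" "rook v y = i" "rook x y = i"
        "rook u z = i"
      by (rule has_F13E)
    then show False by (intro rook_book_free[of x y u v i]) auto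
  qed
  ultimately show ?thesis unfolding extremal_colouring_def using sym by blast
qed

section \<open>Substitution into the two-coloured pentagon\<close>

definition pentagon :: "nat \<Rightarrow> nat \<Rightarrow> bool" where
  "pentagon x y \<longleftrightarrow> (x mod 5 + 1) mod 5 = y mod 5 \<or> (y mod 5 + 1) mod 5 = x mod 5"

text \<open>The 5-cycle and its complement, again a 5-cycle, contain no triangle; all triples of
  residues are checked.\<close>

lemma pentagon_no_mono_triangle:
  assumes "x mod 5 \<noteq> y mod 5" "x mod 5 \<noteq> z mod 5" "y mod 5 \<noteq> z mod 5"
  shows "\<not> (pentagon x y = pentagon x z \<and> pentagon x y = pentagon y z)"
proof -
  have residue: "n mod 5 \<in> {0, 1, 2, 3, 4}" for n :: nat by auto
  have "a \<noteq> b \<Longrightarrow> a \<noteq> c \<Longrightarrow> b \<noteq> c \<Longrightarrow>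
      ((a + 1) mod 5 = b \<or> (b + 1) mod 5 = a) = ((a + 1) mod 5 = c \<or> (c + 1) mod 5 = a) \<Longrightarrow>
      ((a + 1) mod 5 = b \<or> (b + 1) mod 5 = a) \<noteq> ((b + 1) mod 5 = c \<or> (c + 1) mod 5 = b)"
    if "a \<in> {0, 1, 2, 3, 4}" "b \<in> {0, 1, 2, 3, 4}" "c \<in> {0, 1, 2, 3, 4}" for a b c :: nat
    using that by (elim insertE emptyE; simp)
  from this[OF residue residue residue, of x y z] show ?thesis
    unfolding pentagon_def using assms by blast
qed

text \<open>\<open>x mod 5\<close> is the vertex of the pentagon and \<open>x div 5\<close> the
  vertex inside the block substituted for it; the new colours are \<open>k\<close> and
  \<open>Suc k\<close>.\<close>

definition blow_up :: "nat \<Rightarrow> (nat \<Rightarrow> nat \<Rightarrow> nat) \<Rightarrow> nat \<Rightarrow> nat \<Rightarrow> nat" where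
  "blow_up k g x y = (if x mod 5 = y mod 5 then g (x div 5) (y div 5)
     else if pentagon x y then k else Suc k)"

text \<open>A monochromatic triangle lies in one block because the new colours have none. The two
  triangles of \<open>F12\<close> or \<open>F13\<close> overlap, so they share a block, and the
  pendant edge stays in it because its colour is old; hence a copy descends to
  \<open>g\<close>.\<close>

lemma extremal_colouring_blow_up:
  assumes "extremal_colouring k n g"
  shows "extremal_colouring (Suc (Suc k)) (5 * n) (blow_up k g)"
proof -
  let ?h = "blow_up k g"
  have g: "\<And>x y. g x y = g y x" "\<And>x y. g x y < k" "rainbow_triangle_free g {..<n}"
      "\<not> has_F12 g {..<n}" "\<not> has_F13 g {..<n}"
    using assms by (auto simp: extremal_colouring_def)
  have sym: "?h x y = ?h y x" for x y
    using g(1) by (auto simp: blow_up_def pentagon_def)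
  have less: "?h x y < Suc (Suc k)" for x y
    using g(2)[of "x div 5" "y div 5"] by (simp add: blow_up_def less_SucI)
  have div: "x div 5 < n" if "x < 5 * n" for x
    using that by (simp add: less_mult_imp_div_less mult.commute)
  have neq: "x div 5 \<noteq> y div 5" if "x \<noteq> y" "x mod 5 = y mod 5" for x y :: nat
    using that by (metis div_mult_mod_eq)
  have low_iff: "?h x y < k \<longleftrightarrow> x mod 5 = y mod 5" for x y
    using g(2)[of "x div 5" "y div 5"] by (simp add: blow_up_def)
  have tri: "x mod 5 = y mod 5" "x mod 5 = z mod 5"
    if "?h x y = i" "?h x z = i" "?h y z = i" for x y z i
  proof -
    have "i < k"
    proof (rule ccontr)
      assume "\<not> i < k"
      then have "x mod 5 \<noteq> y mod 5" "x mod 5 \<noteq> z mod 5" "y mod 5 \<noteq> z mod 5"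
        using that low_iff by metis+
      then show False
        using pentagon_no_mono_triangle[of x y z] that by (auto simp: blow_up_def split: if_splits)
    qed
    then show "x mod 5 = y mod 5" "x mod 5 = z mod 5" using that low_iff by metis+
  qed
  have inner: "?h x y = g (x div 5) (y div 5)" if "x mod 5 = y mod 5" for x y
    using that by (simp add: blow_up_def)
  have down: "g (x div 5) (y div 5) = i" if "?h x y = i" "x mod 5 = y mod 5" for x y i
    using that inner by simp
  have "rainbow_triangle_free ?h {..<5 * n}"
    unfolding rainbow_triangle_free_def
  proof (intro ballI impI)
    fix x y z
    assume mem: "x \<in> {..<5 * n}" "y \<in> {..<5 * n}" "z \<in> {..<5 * n}"
      and ne: "x \<noteq> y" "x \<noteq> z" "y \<noteq> z"
    \<comment> \<open>Two vertices of one block see a vertex outside it in the same colour, and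
      three different blocks involve only the two new colours.\<close>
    consider "x mod 5 = y mod 5" "x mod 5 = z mod 5"
      | "x mod 5 = y mod 5" "x mod 5 \<noteq> z mod 5" | "x mod 5 = z mod 5" "x mod 5 \<noteq> y mod 5"
      | "y mod 5 = z mod 5" "x mod 5 \<noteq> y mod 5"
      | "x mod 5 \<noteq> y mod 5" "x mod 5 \<noteq> z mod 5" "y mod 5 \<noteq> z mod 5"
      by argo
    then show "?h x y = ?h x z \<or> ?h x y = ?h y z \<or> ?h x z = ?h y z"
    proof cases
      case 1
      have "g (x div 5) (y div 5) = g (x div 5) (z div 5) \<or>
          g (x div 5) (y div 5) = g (y div 5) (z div 5) \<or>
          g (x div 5) (z div 5) = g (y div 5) (z div 5)"
        using mem ne 1 div neq by (intro rainbow_triangle_freeD[OF g(3)]) auto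
      then show ?thesis using 1 inner by simp
    next
      case 2
      then have "?h x z = ?h y z"
        by (simp add: blow_up_def pentagon_def)
      then show ?thesis by simp
    next
      case 3
      then have "?h x y = ?h z y"
        by (simp add: blow_up_def pentagon_def)
      then show ?thesis using sym[of z y] by simp
    next
      case 4
      then have "?h x y = ?h x z"
        by (simp add: blow_up_def pentagon_def)
      then show ?thesis by simp
    next
      case 5
      then show ?thesis by (auto simp: blow_up_def)
    qed
  qed
  moreover have "\<not> has_F12 ?h {..<5 * n}"
  proof
    assume "has_F12 ?h {..<5 * n}"
    then obtain u x y z w i where F: "{u, x, y, z, w} \<subseteq> {..<5 * n}" "distinct [u, x, y, z, w]"
        "?h u x = i" "?h u y = i" "?h u z = i" "?h x y = i" "?h y z = i" "?h u w = i"
      by (rule has_F12E)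
    have m: "u mod 5 = x mod 5" "u mod 5 = y mod 5" using tri[of u x i y] F by blast+
    have m': "u mod 5 = z mod 5" using tri[of u y i z] F by blast
    have m'': "u mod 5 = w mod 5" using m F(3,8) low_iff by metis
    have "has_F12 g {..<n}"
    proof (rule has_F12I)
      show "{u div 5, x div 5, y div 5, z div 5, w div 5} \<subseteq> {..<n}" using F(1) div by auto
      show "distinct [u div 5, x div 5, y div 5, z div 5, w div 5]"
        using F(2) neq m m' m'' by auto
    qed (rule down, fact, use m m' m'' in argo)+
    then show False using g(4) by simp
  qed
  moreover have "\<not> has_F13 ?h {..<5 * n}"
  proof
    assume "has_F13 ?h {..<5 * n}"
    then obtain u v x y z i where F: "{u, v, x, y, z} \<subseteq> {..<5 * n}" "distinct [u, v, x, y, z]"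
        "?h u x = i" "?h u y = i" "?h v x = i" "?h v y = i" "?h x y = i" "?h u z = i"
      by (rule has_F13E)
    have m: "u mod 5 = x mod 5" "u mod 5 = y mod 5" using tri[of u x i y] F by blast+
    have m': "v mod 5 = x mod 5" using tri[of v x i y] F by blast
    have m'': "u mod 5 = z mod 5" using m F(3,8) low_iff by metis
    have "has_F13 g {..<n}"
    proof (rule has_F13I)
      show "{u div 5, v div 5, x div 5, y div 5, z div 5} \<subseteq> {..<n}" using F(1) div by auto
      show "distinct [u div 5, v div 5, x div 5, y div 5, z div 5]"
        using F(2) neq m m' m'' by auto
    qed (rule down, fact, use m m' m'' in argo)+
    then show False using g(5) by simp
  qed
  ultimately show ?thesis
    unfolding extremal_colouring_def by (intro conjI allI sym less)
qed

section \<open>Extremal colourings for all \<open>k\<close> and the value of the Ramsey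
  numbers\<close>

lemma ex_extremal_colouring:
  assumes "k \<ge> 1"
  shows "\<exists>g. extremal_colouring k (extremal_order k) g"
  using assms
proof (induction k rule: less_induct)
  case (less k)
  consider "k = Suc 0" | "k = Suc (Suc 0)" | l where "k = Suc (Suc l)" "l \<ge> 1"
    using less.prems by (metis One_nat_def Suc_le_D le_zero_eq not_less_eq_eq)
  then show ?case
  proof cases
    case 1
    then show ?thesis using extremal_colouring_1 by (auto simp: extremal_order_1)
  next
    case 2
    then show ?thesis using extremal_colouring_2 by (auto simp: extremal_order_2)
  next
    case 3
    then obtain g where "extremal_colouring l (extremal_order l) g"
      using less.IH[of l] by auto
    then show ?thesis
      using extremal_colouring_blow_up 3 by (auto simp: extremal_order_add_2)
  qed
qed

text \<open>The predicate \<open>has\<close> stands for either forbidden pattern, so that the upper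
  and the lower bound are combined only once.\<close>

lemma gallai_ramsey_triangle_eq:
  fixes H :: "'b graph"
  assumes "k \<ge> 1"
    and copy: "\<And>N c. (\<exists>H'. is_copy_in H' H (complete_graph N) \<and> monochromatic c H') \<longleftrightarrow>
      has (\<lambda>x y. c {x, y}) {..<N}"
    and mono: "\<And>d A B. has d A \<Longrightarrow> A \<subseteq> B \<Longrightarrow> has d B"
    and sparse: "\<And>d V. finite V \<Longrightarrow> (\<And>x y. d x y = d y x) \<Longrightarrow> rainbow_triangle_free d V \<Longrightarrow>
      \<not> has d V \<Longrightarrow> sparse_colouring d V"
    and lower: "\<And>g n. extremal_colouring k n g \<Longrightarrow> \<not> has g {..<n}"
  shows "gallai_ramsey k (complete_graph 3) H = extremal_order k + 1"
proof -
  define good where "good N \<longleftrightarrow> (\<forall>c. edge_coloring k (complete_graph N) c \<longrightarrow>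
      \<not> rainbow_triangle_free (\<lambda>x y. c {x, y}) {..<N} \<or> has (\<lambda>x y. c {x, y}) {..<N})" for N
  have "gallai_ramsey k (complete_graph 3) H = (LEAST N. good N)"
    unfolding gallai_ramsey_def rainbow_copy_triangle_iff copy good_def Inf_nat_def by simp
  also have "\<dots> = extremal_order k + 1"
  proof (rule Least_equality)
    show "good (extremal_order k + 1)"
      unfolding good_def
    proof (intro allI impI)
      let ?V = "{..<extremal_order k + 1}"
      fix c
      assume c: "edge_coloring k (complete_graph (extremal_order k + 1)) c"
      let ?d = "\<lambda>x y. c {x, y}"
      show "\<not> rainbow_triangle_free ?d ?V \<or> has ?d ?V"
      proof (rule ccontr)
        assume "\<not> ?thesis"
        then have "sparse_colouring ?d ?V"
          by (intro sparse) (auto simp: insert_commute)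
        moreover have "\<forall>x\<in>?V. \<forall>y\<in>?V. x \<noteq> y \<longrightarrow> ?d x y \<in> {..<k}"
          using c by (simp add: edge_coloring_def complete_graph_def edges_def)
        ultimately have "card ?V \<le> extremal_order k"
          using sparse_colouring.card_le_extremal_order[of ?d ?V ?V "{..<k}" k] assms(1) by simp
        then show False by simp
      qed
    qed
  next
    fix N
    assume N: "good N"
    show "extremal_order k + 1 \<le> N"
    proof (rule ccontr)
      assume "\<not> ?thesis"
      \<comment> \<open>A smaller \<open>N\<close> is refuted by restricting the extremal colouring
        to it.\<close>
      then have sub: "{..<N} \<subseteq> {..<extremal_order k}" by auto
      obtain g where g: "extremal_colouring k (extremal_order k) g"
        using ex_extremal_colouring[OF assms(1)] by blast
      \<comment> \<open>Turns a symmetric function of two vertices into a colouring of sets. On a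
        singleton minimum and maximum coincide, so the diagonal of \<open>g\<close> is recovered too
        and the functions below are equal everywhere.\<close>
      define c where "c e = g (Min e) (Max e)" for e
      have c: "(\<lambda>x y. c {x, y}) = g"
      proof (intro ext)
        show "c {x, y} = g x y" for x y
          using g by (cases "x \<le> y") (simp_all add: c_def extremal_colouring_def min_def max_def)
      qed
      have "edge_coloring k (complete_graph N) c"
        using g by (simp add: edge_coloring_def c_def extremal_colouring_def)
      then have "\<not> rainbow_triangle_free (\<lambda>x y. c {x, y}) {..<N} \<or> has (\<lambda>x y. c {x, y}) {..<N}"
        using N unfolding good_def by blast
      then have "\<not> rainbow_triangle_free g {..<N} \<or> has g {..<N}"
        unfolding c .
      moreover have "rainbow_triangle_free g {..<N}"
        using g rainbow_triangle_free_subset[OF _ sub] unfolding extremal_colouring_def by blast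
      ultimately show False using mono[OF _ sub] lower[OF g] by blast
    qed
  qed
  finally show ?thesis .
qed

theorem theorem1p4:
  fixes k :: nat
  assumes "k \<ge> 1"
  shows "gallai_ramsey k (complete_graph 3) F12 = gallai_ramsey k (complete_graph 3) F13 \<and>
         gallai_ramsey k (complete_graph 3) F13 =
           (if even k then 9 * 5 ^ ((k - 2) div 2) + 1 else 4 * 5 ^ ((k - 1) div 2) + 1)"
proof -
  have "gallai_ramsey k (complete_graph 3) F12 = extremal_order k + 1"
    by (rule gallai_ramsey_triangle_eq[OF assms mono_copy_F12_iff has_F12_mono
          sparse_colouring_F12]) (auto simp: extremal_colouring_def)
  moreover have "gallai_ramsey k (complete_graph 3) F13 = extremal_order k + 1"
    by (rule gallai_ramsey_triangle_eq[OF assms mono_copy_F13_iff has_F13_mono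
          sparse_colouring_F13]) (auto simp: extremal_colouring_def)
  ultimately show ?thesis by (simp add: extremal_order_def)
qed

end
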